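(* For $\epsilon>0$ let $\Sigma(\epsilon)=(\mathbb{R}^2\setminus\sqrt{\epsilon}\,\mathbb{Z}^2)/\sqrt{\epsilon}\,\mathbb{Z}^2$, i.e. the torus $\mathbb{R}^2/\sqrt{\epsilon}\,\mathbb{Z}^2$ with the image of the lattice point removed, with its induced symplectic form (total area $\epsilon$). There exist constants $\epsilon_0>0$, $c>0$ and a smooth family $(J_\epsilon)_{\epsilon\in(0,\epsilon_0]}$ of symplectic embeddings $$J_\epsilon\colon \Sigma(\epsilon)\times\mathrm{B}^2(1)\hookrightarrow \mathrm{B}^4(\sqrt{3}+c\epsilon).$$
   Context: $\mathbb{R}^{2m}$ carries the standard symplectic form $\sum \mathrm{d}x_i\wedge\mathrm{d}y_i$, and $\mathrm{B}^{2m}(\rho)$ denotes the open ball of radius $\rho$ centered at the origin. $\Sigma(\epsilon)$ inherits the form $\mathrm{d}x\wedge\mathrm{d}y$ from $\mathbb{R}^2$, and $\Sigma(\epsilon)\times\mathrm{B}^2(1)$ carries the product symplectic form. Smooth families: for smooth manifolds $P,M,N$ and submanifolds $B_p\subset N$, a family of embeddings $(\phi_p\colon B_p\hookrightarrow M)_{p\in P}$ is smooth if there is a smooth manifold $B$ and a smooth map $g\colon P\times B\to N$ with each $g(p,\cdot)$ an immersion and $B_p=g(p,B)$, such that $(p,b)\mapsto\phi_p(g(p,b))$ is smooth; when $P$ is a subset of a manifold $\tilde P$ (here $P=(0,\epsilon_0]\subset\mathbb{R}$) one requires these maps to extend smoothly to an open neighborhood of $P$. Here the domains $\Sigma(\epsilon)\times\mathrm{B}^2(1)$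 are parametrized by $\Sigma(1)\times\mathrm{B}^2(1)$ via the map induced by the dilation $x\mapsto\sqrt{\epsilon}\,x$ on the first factor. *)

theory Defs
  imports "HOL-Analysis.Analysis"
begin

text \<open>C-infinity smoothness on a set (intended for open sets): f is differentiable
  at every point of S, continuous on S, and every directional derivative
  x \<mapsto> D x v is again smooth on S.  In finite dimensions this is exactly C-infinity.\<close>
coinductive smooth_on :: "'a::euclidean_space set \<Rightarrow> ('a \<Rightarrow> 'b::real_normed_vector) \<Rightarrow> bool"
  for S :: "'a set" where
  "continuous_on S f \<Longrightarrow>
   (\<exists>D. (\<forall>x\<in>S. (f has_derivative D x) (at x)) \<and> (\<forall>v. smooth_on S (\<lambda>x. D x v)))
   \<Longrightarrow> smooth_on S f"

definition lattice :: "real \<Rightarrow> (real \<times> real) set" where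
  "lattice s = {(s * of_int m, s * of_int n) | m n. True}"

text \<open>Lift of Sigma(eps) x B^2(1) to the cover: (R^2 minus sqrt(eps) Z^2) x B^2(1).\<close>
definition cover_dom :: "real \<Rightarrow> ((real \<times> real) \<times> (real \<times> real)) set" where
  "cover_dom e = (UNIV - lattice (sqrt e)) \<times> ball 0 1"

definition omega :: "(real \<times> real) \<times> (real \<times> real) \<Rightarrow> (real \<times> real) \<times> (real \<times> real) \<Rightarrow> real" where
  "omega v w = fst (fst v) * snd (fst w) - snd (fst v) * fst (fst w)
             + fst (snd v) * snd (snd w) - snd (snd v) * fst (snd w)"

text \<open>J, a map on the cover, descends to a symplectic embedding
  Sigma(e) x B^2(1) into B^4(r).\<close>
definition torus_symp_embedding ::
  "real \<Rightarrow> real \<Rightarrow> ((real \<times> real) \<times> (real \<times> real) \<Rightarrow> (real \<times> real) \<times> (real \<times> real)) \<Rightarrow> bool" where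
  "torus_symp_embedding e r J \<longleftrightarrow>
     smooth_on (cover_dom e) J
   \<and> (\<forall>q\<in>cover_dom e. \<forall>l\<in>lattice (sqrt e). J (fst q + l, snd q) = J q)
   \<and> (\<forall>q\<in>cover_dom e. \<exists>D. (J has_derivative D) (at q) \<and> (\<forall>v w. omega (D v) (D w) = omega v w))
   \<and> (\<forall>q1\<in>cover_dom e. \<forall>q2\<in>cover_dom e. J q1 = J q2 \<longrightarrow>
         snd q1 = snd q2 \<and> fst q1 - fst q2 \<in> lattice (sqrt e))
   \<and> (\<forall>p\<in>cover_dom e. \<forall>\<delta>>0. \<exists>\<eta>>0. \<forall>q\<in>cover_dom e. dist (J q) (J p) < \<eta> \<longrightarrow>
         (\<exists>l\<in>lattice (sqrt e). dist (fst q + l, snd q) p < \<delta>))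
   \<and> J ` cover_dom e \<subseteq> ball 0 r"

text \<open>Smoothness of the family in e \<in> (0, e0], with domains parametrized by
  Sigma(1) x B^2(1) via (u,z) \<mapsto> (sqrt e u, z), extending smoothly to an open neighbourhood.\<close>
definition smooth_torus_family ::
  "real \<Rightarrow> (real \<Rightarrow> (real \<times> real) \<times> (real \<times> real) \<Rightarrow> (real \<times> real) \<times> (real \<times> real)) \<Rightarrow> bool" where
  "smooth_torus_family e0 J \<longleftrightarrow>
     (\<exists>W G. open W \<and> {0<..e0} \<times> cover_dom 1 \<subseteq> W \<and> smooth_on W G
        \<and> (\<forall>e\<in>{0<..e0}. \<forall>q\<in>cover_dom 1. G (e, q) = J e (sqrt e *\<^sub>R fst q, snd q)))"

end

theory Submission
  imports Defs
begin

text \<open>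
  The punctured torus is immersed in the plane as two bands that run around an annulus and meet twice: once where
  the torus branches, and once in a double crossing. To separate the two bands at the crossing in dimension four,
  the fibre disc over one band, first straightened to a rectangle of sides \<open>pi\<close> and 1, is translated by its
  height 1 before the crossing and moved back afterwards. A translation by \<open>s\<close> is generated by a Hamiltonian of
  oscillation \<open>pi * s\<close>, so the two motions sweep out area \<open>2 * pi\<close> in the base, up to \<open>O(e)\<close>. Finally the base
  and the fibre are mapped to discs by symplectic polar coordinates, with the crossing at the centre of the base
  disc. Where the fibre has been translated by \<open>s\<close> it lies in the disc of area \<open>pi * (1 + s)\<close> while the base
  lies in the disc of area \<open>2 * pi * (1 - s) + O(e)\<close>; the sum is at most \<open>3 * pi + O(e)\<close>.

  The immersion comes from an area-preserving map that opens every puncture to a slit, after which the circles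
  \<open>X = const\<close> are all cut and a coordinate conjugate to \<open>X\<close> exists.
\<close>

section \<open>Calculus of smooth functions\<close>

text \<open>The base is modelled once and for all on the unit torus carrying \<open>e\<close> times
  its area form. Thus \<open>P\<close> and \<open>Q\<close> do not depend on \<open>e\<close>, the
  annulus itself costs only \<open>O(e)\<close> of area, and what survives for small
  \<open>e\<close> is the area swept by the two motions. Each of the values of \<open>P\<close> at
  which the fibre moves is passed twice by the annulus, once in the upper and once in the lower half
  plane. Both motions therefore share one circle of the base disc and use half a turn each; the
  circle shrinks with \<open>P\<close> at twice the rate at which the fibre grows, which is why the
  total never exceeds its initial value. The constants keep three regions apart. Slits of both kinds
  are present for \<open>\<bar>cos (pi * X)\<bar> \<le> 4/5\<close>, which covers
  \<open>P > 0\<close>, where the squared cosine is below 1/2. The fibre moves for \<open>P\<close>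
  between 1 and 2. The sheets exchange heights only where the cosine is at most 1/3 in absolute
  value; as the radius exceeds 3, \<open>P\<close> is then at least 9/4.\<close>

text \<open>A finite-order version of \<open>smooth_on\<close> that allows closure properties to be proved by induction on the
  order instead of coinduction up to algebraic operations.\<close>

primrec Ck :: "nat \<Rightarrow> 'a::euclidean_space set \<Rightarrow> ('a \<Rightarrow> 'b::real_normed_vector) \<Rightarrow> bool" where
  "Ck 0 S f \<longleftrightarrow> continuous_on S f"
| "Ck (Suc k) S f \<longleftrightarrow> (\<forall>x\<in>S. f differentiable (at x)) \<and>
     (\<forall>v. Ck k S (\<lambda>x. frechet_derivative f (at x) v))"

lemma frechet_derivative_eq_on_open:
  assumes "open S" "x \<in> S" "\<And>y. y \<in> S \<Longrightarrow> f y = g y"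
  shows "frechet_derivative f (at x) = frechet_derivative g (at x)"
proof -
  have "(f has_derivative D) (at x) \<longleftrightarrow> (g has_derivative D) (at x)" for D
    using has_derivative_transform_within_open[OF _ assms(1,2), of f D UNIV g]
      has_derivative_transform_within_open[OF _ assms(1,2), of g D UNIV f] assms(3) by auto
  then show ?thesis by (simp add: frechet_derivative_def)
qed

lemma differentiable_eq_on_open:
  assumes "open S" "x \<in> S" "\<And>y. y \<in> S \<Longrightarrow> f y = g y" "f differentiable (at x)"
  shows "g differentiable (at x)"
  using has_derivative_transform_within_open[OF _ assms(1,2), of f _ UNIV g] assms(3,4)
  unfolding differentiable_def by auto

lemma Ck_cong:
  assumes "open S" "\<And>x. x \<in> S \<Longrightarrow> f x = g x" "Ck k S f"
  shows "Ck k S g"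
  using assms(2,3)
proof (induction k arbitrary: f g)
  case 0
  then show ?case using continuous_on_eq[of S f g] by simp
next
  case (Suc k)
  have "Ck k S (\<lambda>x. frechet_derivative g (at x) v)" for v
    using Suc.IH[of "\<lambda>x. frechet_derivative f (at x) v"] Suc.prems
      frechet_derivative_eq_on_open[OF assms(1), of _ f g] by auto
  then show ?case
    using Suc.prems differentiable_eq_on_open[OF assms(1), of _ f g] by auto
qed

lemma Ck_SucI:
  assumes "open S" "\<And>x. x \<in> S \<Longrightarrow> (f has_derivative D x) (at x)"
    "\<And>v. Ck k S (\<lambda>x. D x v)"
  shows "Ck (Suc k) S f"
proof -
  have "Ck k S (\<lambda>x. frechet_derivative f (at x) v)" for v
    by (rule Ck_cong[OF assms(1) _ assms(3)[of v]])
      (simp add: frechet_derivative_at[OF assms(2), symmetric])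
  then show ?thesis using assms(2) by (auto simp: differentiable_def)
qed

lemma Ck_SucD:
  assumes "Ck (Suc k) S f"
  obtains D where "\<And>x. x \<in> S \<Longrightarrow> (f has_derivative D x) (at x)" "\<And>v. Ck k S (\<lambda>x. D x v)"
  using assms that[of "\<lambda>x. frechet_derivative f (at x)"] by (auto simp: frechet_derivative_works)

lemma Ck_continuous_on: "Ck k S f \<Longrightarrow> continuous_on S f"
  by (cases k) (auto intro!: differentiable_imp_continuous_on
      simp: differentiable_on_def differentiable_at_withinI)

lemma Ck_Suc_imp_Ck: "Ck (Suc k) S f \<Longrightarrow> Ck k S f"
proof (induction k arbitrary: f)
  case 0
  then show ?case using Ck_continuous_on by (metis Ck.simps(1))
next
  case (Suc k)
  then show ?case by (simp only: Ck.simps(2)[of "Suc k"] Ck.simps(2)[of k]) auto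
qed

text \<open>The converse is the one use of coinduction. Its witness is the Frechet derivative: its
  directional derivatives lie in every \<open>Ck k\<close> because \<open>f\<close> lies in every
  \<open>Ck (Suc k)\<close>.\<close>

lemma smooth_on_iff_Ck:
  fixes f :: "'a::euclidean_space \<Rightarrow> 'b::real_normed_vector"
  assumes "open S"
  shows "smooth_on S f \<longleftrightarrow> (\<forall>k. Ck k S f)"
proof
  assume *: "smooth_on S f"
  have "\<forall>f::'a \<Rightarrow> 'b. smooth_on S f \<longrightarrow> Ck k S f" for k
  proof (induction k)
    case 0
    then show ?case by (auto elim: smooth_on.cases)
  next
    case (Suc k)
    show ?case
    proof (intro allI impI)
      fix f :: "'a \<Rightarrow> 'b" assume "smooth_on S f"
      then obtain D where D: "\<forall>x\<in>S. (f has_derivative D x) (at x)" "\<forall>v. smooth_on S (\<lambda>x. D x v)"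
        by (auto elim: smooth_on.cases)
      have "Ck k S (\<lambda>x. D x v)" for v using Suc D(2) by simp
      with D(1) show "Ck (Suc k) S f" by (intro Ck_SucI[OF assms, of f D]) auto
    qed
  qed
  with * show "\<forall>k. Ck k S f" by blast
next
  assume "\<forall>k. Ck k S f"
  then show "smooth_on S f"
  proof (coinduction arbitrary: f)
    case smooth_on
    then have *: "\<And>k. Ck (Suc k) S f" by blast
    have "(f has_derivative frechet_derivative f (at x)) (at x)" if "x \<in> S" for x
      using *[of 0] that by (simp add: frechet_derivative_works)
    moreover have "Ck k S (\<lambda>x. frechet_derivative f (at x) v)" for k v
      using *[of k] by simp
    ultimately show ?case
      using Ck_continuous_on[of 0 S f] smooth_on
      by (auto intro!: exI[of _ "\<lambda>x. frechet_derivative f (at x)"])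
  qed
qed

section \<open>Closure properties at finite order\<close>

lemma Ck_const: "open S \<Longrightarrow> Ck k S (\<lambda>x. c)"
proof (induction k arbitrary: c)
  case (Suc k)
  then show ?case by (intro Ck_SucI[where D="\<lambda>x v. 0"]) auto
qed auto

lemma Ck_bounded_linear: "open S \<Longrightarrow> bounded_linear L \<Longrightarrow> Ck k S L"
proof (cases k)
  case 0
  assume "bounded_linear L"
  then show ?thesis using 0 by (auto simp: linear_continuous_on)
next
  case (Suc j)
  assume "open S" "bounded_linear L"
  then show ?thesis unfolding Suc
    by (intro Ck_SucI[where D="\<lambda>x. L"]) (auto simp: Ck_const bounded_linear_imp_has_derivative)
qed

lemma Ck_add:
  assumes "open S" shows "Ck k S f \<Longrightarrow> Ck k S g \<Longrightarrow> Ck k S (\<lambda>x. f x + g x)"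
proof (induction k arbitrary: f g)
  case 0
  then show ?case by (auto intro: continuous_on_add)
next
  case (Suc k)
  from Ck_SucD[OF Suc.prems(1)] obtain D where D: "\<And>x. x \<in> S \<Longrightarrow> (f has_derivative D x) (at x)"
    "\<And>v. Ck k S (\<lambda>x. D x v)" by blast
  from Ck_SucD[OF Suc.prems(2)] obtain D' where D': "\<And>x. x \<in> S \<Longrightarrow> (g has_derivative D' x) (at x)"
    "\<And>v. Ck k S (\<lambda>x. D' x v)" by blast
  show ?case
    by (rule Ck_SucI[where D="\<lambda>x v. D x v + D' x v"])
      (use assms Suc.IH D D' in \<open>auto intro: has_derivative_add\<close>)
qed

lemma Ck_sum:
  assumes "open S" "finite I" "\<And>i. i \<in> I \<Longrightarrow> Ck k S (f i)"
  shows "Ck k S (\<lambda>x. \<Sum>i\<in>I. f i x)"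
  using assms(2,3) by (induction I rule: finite_induct) (auto simp: assms(1) Ck_const intro: Ck_add)

lemma Ck_scaleR:
  fixes f :: "'a::euclidean_space \<Rightarrow> real"
  assumes "open S" shows "Ck k S f \<Longrightarrow> Ck k S g \<Longrightarrow> Ck k S (\<lambda>x. f x *\<^sub>R g x)"
proof (induction k arbitrary: f g)
  case 0
  then show ?case by (auto intro: continuous_on_scaleR)
next
  case (Suc k)
  from Ck_SucD[OF Suc.prems(1)] obtain D where D: "\<And>x. x \<in> S \<Longrightarrow> (f has_derivative D x) (at x)"
    "\<And>v. Ck k S (\<lambda>x. D x v)" by blast
  from Ck_SucD[OF Suc.prems(2)] obtain D' where D': "\<And>x. x \<in> S \<Longrightarrow> (g has_derivative D' x) (at x)"
    "\<And>v. Ck k S (\<lambda>x. D' x v)" by blast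
  show ?case
  proof (rule Ck_SucI[where D="\<lambda>x v. f x *\<^sub>R D' x v + D x v *\<^sub>R g x"])
    show "((\<lambda>x. f x *\<^sub>R g x) has_derivative (\<lambda>v. f x *\<^sub>R D' x v + D x v *\<^sub>R g x)) (at x)"
      if "x \<in> S" for x
      using has_derivative_scaleR[OF D(1) D'(1)] that by blast
    show "Ck k S (\<lambda>x. f x *\<^sub>R D' x v + D x v *\<^sub>R g x)" for v
      using Ck_Suc_imp_Ck[OF Suc.prems(1)] Ck_Suc_imp_Ck[OF Suc.prems(2)]
      by (intro Ck_add[OF assms] Suc.IH D D')
  qed (fact assms)
qed

lemma Ck_bounded_linear_compose:
  assumes "open S" "bounded_linear L"
  shows "Ck k S f \<Longrightarrow> Ck k S (\<lambda>x. L (f x))"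
proof (induction k arbitrary: f)
  case 0
  then show ?case using assms(2) by (auto intro: bounded_linear.continuous_on)
next
  case (Suc k)
  from Ck_SucD[OF Suc.prems] obtain D where D: "\<And>x. x \<in> S \<Longrightarrow> (f has_derivative D x) (at x)"
    "\<And>v. Ck k S (\<lambda>x. D x v)" by blast
  show ?case
    by (rule Ck_SucI[where D="\<lambda>x v. L (D x v)"])
      (use assms D Suc.IH[OF D(2)] in \<open>auto intro: bounded_linear.has_derivative\<close>)
qed

text \<open>The chain rule applies the derivative of \<open>h\<close> to a direction that varies
  with \<open>x\<close>, whereas \<open>Ck\<close> speaks of fixed directions only. Expansion in the
  basis gives a finite sum of products that the induction hypothesis covers.\<close>

lemma Ck_compose:
  fixes h :: "'b::euclidean_space \<Rightarrow> 'c::real_normed_vector" and g :: "'a::euclidean_space \<Rightarrow> 'b"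
  assumes "open S" "open T" "\<And>x. x \<in> S \<Longrightarrow> g x \<in> T"
  shows "Ck k T h \<Longrightarrow> Ck k S g \<Longrightarrow> Ck k S (\<lambda>x. h (g x))"
proof (induction k arbitrary: h)
  case 0
  then show ?case using assms(3) by (auto intro: continuous_on_compose2)
next
  case (Suc k)
  from Ck_SucD[OF Suc.prems(1)] obtain D where D: "\<And>x. x \<in> T \<Longrightarrow> (h has_derivative D x) (at x)"
    "\<And>v. Ck k T (\<lambda>x. D x v)" by blast
  from Ck_SucD[OF Suc.prems(2)] obtain D' where D': "\<And>x. x \<in> S \<Longrightarrow> (g has_derivative D' x) (at x)"
    "\<And>v. Ck k S (\<lambda>x. D' x v)" by blast
  show ?case
  proof (rule Ck_SucI[where D="\<lambda>x v. \<Sum>b\<in>Basis. (D' x v \<bullet> b) *\<^sub>R D (g x) b"])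
    fix x assume x: "x \<in> S"
    have "linear (D (g x))"
      using D(1)[OF assms(3)[OF x]] has_derivative_linear by blast
    then have "D (g x) (D' x v) = (\<Sum>b\<in>Basis. (D' x v \<bullet> b) *\<^sub>R D (g x) b)" for v
      by (subst euclidean_representation[of "D' x v", symmetric])
        (simp only: linear_sum linear_cmul)
    then show "((\<lambda>x. h (g x)) has_derivative (\<lambda>v. \<Sum>b\<in>Basis. (D' x v \<bullet> b) *\<^sub>R D (g x) b)) (at x)"
      using has_derivative_compose[OF D'(1)[OF x] D(1)[OF assms(3)[OF x]]] by simp
  next
    fix v
    have "Ck k S (\<lambda>x. D' x v \<bullet> b)" for b
      using Ck_bounded_linear_compose[OF assms(1) bounded_linear_inner_left D'(2)] .
    moreover have "Ck k S (\<lambda>x. D (g x) b)" for b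
      using Suc.IH[OF D(2)] Ck_Suc_imp_Ck Suc.prems(2) by blast
    ultimately show "Ck k S (\<lambda>x. \<Sum>b\<in>Basis. (D' x v \<bullet> b) *\<^sub>R D (g x) b)"
      by (intro Ck_sum Ck_scaleR assms(1)) auto
  qed (fact assms(1))
qed

lemma Ck_Pair:
  assumes "open S" shows "Ck k S f \<Longrightarrow> Ck k S g \<Longrightarrow> Ck k S (\<lambda>x. (f x, g x))"
proof (induction k arbitrary: f g)
  case 0
  then show ?case by (auto intro: continuous_on_Pair)
next
  case (Suc k)
  from Ck_SucD[OF Suc.prems(1)] obtain D where D: "\<And>x. x \<in> S \<Longrightarrow> (f has_derivative D x) (at x)"
    "\<And>v. Ck k S (\<lambda>x. D x v)" by blast
  from Ck_SucD[OF Suc.prems(2)] obtain D' where D': "\<And>x. x \<in> S \<Longrightarrow> (g has_derivative D' x) (at x)"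
    "\<And>v. Ck k S (\<lambda>x. D' x v)" by blast
  show ?case
    by (rule Ck_SucI[where D="\<lambda>x v. (D x v, D' x v)"])
      (use assms Suc.IH D D' in \<open>auto intro: has_derivative_Pair\<close>)
qed

text \<open>Derivatives are taken at \<open>x\<close> and not within \<open>S\<close>, so only germs
  matter. Through this lemma, maps whose defining formula jumps are shown to be smooth from local
  formulas.\<close>

lemma Ck_local:
  assumes "\<And>x. x \<in> S \<Longrightarrow> \<exists>U. open U \<and> x \<in> U \<and> Ck k U f"
  shows "Ck k S f"
  using assms
proof (induction k arbitrary: f)
  case 0
  have "continuous (at x within S) f" if "x \<in> S" for x
    using 0[OF that] by (auto simp: continuous_on_eq_continuous_at continuous_at_imp_continuous_at_within)
  then show ?case by (simp add: continuous_on_eq_continuous_within)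
next
  case (Suc k)
  have "f differentiable (at x)" if "x \<in> S" for x
    using Suc.prems[OF that] by auto
  moreover have "Ck k S (\<lambda>x. frechet_derivative f (at x) v)" for v
  proof (rule Suc.IH)
    fix x assume "x \<in> S"
    with Suc.prems obtain U where "open U" "x \<in> U" "Ck (Suc k) U f" by blast
    then show "\<exists>U. open U \<and> x \<in> U \<and> Ck k U (\<lambda>x. frechet_derivative f (at x) v)" by auto
  qed
  ultimately show ?case by simp
qed


section \<open>Closure properties of smooth functions\<close>

lemma smooth_on_const: "open S \<Longrightarrow> smooth_on S (\<lambda>x. c)"
  by (simp add: smooth_on_iff_Ck Ck_const)

lemma smooth_on_bounded_linear: "open S \<Longrightarrow> bounded_linear L \<Longrightarrow> smooth_on S L"
  by (simp add: smooth_on_iff_Ck Ck_bounded_linear)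

lemma smooth_on_add:
  "open S \<Longrightarrow> smooth_on S f \<Longrightarrow> smooth_on S g \<Longrightarrow> smooth_on S (\<lambda>x. f x + g x)"
  by (simp add: smooth_on_iff_Ck Ck_add)

lemma smooth_on_mult:
  fixes f g :: "'a::euclidean_space \<Rightarrow> real"
  shows "open S \<Longrightarrow> smooth_on S f \<Longrightarrow> smooth_on S g \<Longrightarrow> smooth_on S (\<lambda>x. f x * g x)"
  using Ck_scaleR[of S _ f g] by (simp add: smooth_on_iff_Ck)

lemma smooth_on_Pair:
  "open S \<Longrightarrow> smooth_on S f \<Longrightarrow> smooth_on S g \<Longrightarrow> smooth_on S (\<lambda>x. (f x, g x))"
  by (simp add: smooth_on_iff_Ck Ck_Pair)

lemma smooth_on_compose:
  assumes "open S" "open T" "\<And>x. x \<in> S \<Longrightarrow> g x \<in> T" "smooth_on T h" "smooth_on S g"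
  shows "smooth_on S (\<lambda>x. h (g x))"
  using Ck_compose[OF assms(1,2), of g _ h] assms(3-5) by (simp add: smooth_on_iff_Ck assms(1,2))

lemma smooth_on_bounded_linear_compose:
  assumes "open S" "bounded_linear L" "smooth_on S f"
  shows "smooth_on S (\<lambda>x. L (f x))"
  using Ck_bounded_linear_compose[OF assms(1,2)] assms by (simp add: smooth_on_iff_Ck)

lemma smooth_on_fst: "open S \<Longrightarrow> smooth_on S f \<Longrightarrow> smooth_on S (\<lambda>x. fst (f x))"
  by (rule smooth_on_bounded_linear_compose[OF _ bounded_linear_fst])

lemma smooth_on_snd: "open S \<Longrightarrow> smooth_on S f \<Longrightarrow> smooth_on S (\<lambda>x. snd (f x))"
  by (rule smooth_on_bounded_linear_compose[OF _ bounded_linear_snd])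

lemma smooth_on_ident: "open S \<Longrightarrow> smooth_on S (\<lambda>x. x)"
  by (rule smooth_on_bounded_linear) (auto intro: bounded_linear_ident)

lemma smooth_on_uminus: "open S \<Longrightarrow> smooth_on S f \<Longrightarrow> smooth_on S (\<lambda>x. - f x)"
  using smooth_on_bounded_linear_compose[OF _ bounded_linear_minus[OF bounded_linear_ident]] .

lemma smooth_on_diff:
  "open S \<Longrightarrow> smooth_on S f \<Longrightarrow> smooth_on S g \<Longrightarrow> smooth_on S (\<lambda>x. f x - g x)"
  using smooth_on_add[of S f "\<lambda>x. - g x"] smooth_on_uminus[of S g] by simp

lemma smooth_on_power:
  fixes f :: "'a::euclidean_space \<Rightarrow> real"
  assumes "open S" "smooth_on S f"
  shows "smooth_on S (\<lambda>x. f x ^ n)"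
  by (induction n) (auto intro: smooth_on_mult smooth_on_const assms)

lemma smooth_on_imp_continuous_on: "smooth_on S f \<Longrightarrow> continuous_on S f"
  by (auto elim: smooth_on.cases)

lemma smooth_on_subset:
  assumes "open S" "open T" "smooth_on T f" "S \<subseteq> T"
  shows "smooth_on S f"
  using smooth_on_compose[of S T "\<lambda>x. x" f] smooth_on_ident assms by blast

lemma smooth_on_cong:
  assumes "open S" "\<And>x. x \<in> S \<Longrightarrow> f x = g x" "smooth_on S f"
  shows "smooth_on S g"
  using Ck_cong[OF assms(1,2)] assms by (simp add: smooth_on_iff_Ck)

lemma smooth_on_local:
  assumes "open S" "\<And>x. x \<in> S \<Longrightarrow> \<exists>U. open U \<and> x \<in> U \<and> smooth_on U f"
  shows "smooth_on S f"
  unfolding smooth_on_iff_Ck[OF assms(1)]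
proof (intro allI Ck_local)
  fix k x assume "x \<in> S"
  then obtain U where "open U" "x \<in> U" "smooth_on U f" using assms(2) by blast
  then show "\<exists>U. open U \<and> x \<in> U \<and> Ck k U f" using smooth_on_iff_Ck by blast
qed

lemma Ck_SucI_real:
  fixes f f' :: "real \<Rightarrow> real"
  assumes "open S" "\<And>x. x \<in> S \<Longrightarrow> (f has_real_derivative f' x) (at x)" "Ck k S f'"
  shows "Ck (Suc k) S f"
proof (rule Ck_SucI[where D="\<lambda>x v. v *\<^sub>R f' x"])
  show "(f has_derivative (\<lambda>v. v *\<^sub>R f' x)) (at x)" if "x \<in> S" for x
    using assms(2)[OF that] by (simp add: has_field_derivative_def mult_commute_abs)
  show "Ck k S (\<lambda>x. v *\<^sub>R f' x)" for v
    using Ck_scaleR[OF assms(1) Ck_const[OF assms(1), of k v] assms(3)] .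
qed (fact assms(1))

text \<open>Gives smoothness of functions known mainly through their derivative, here
  \<open>arcsin\<close> and \<open>r0\<close>.\<close>

lemma smooth_on_antiderivative:
  fixes f f' :: "real \<Rightarrow> real"
  assumes "open S" "\<And>x. x \<in> S \<Longrightarrow> (f has_real_derivative f' x) (at x)" "smooth_on S f'"
  shows "smooth_on S f"
  using Ck_SucI_real[OF assms(1,2)] assms Ck_Suc_imp_Ck by (simp add: smooth_on_iff_Ck) blast

lemma smooth_on_deriv:
  fixes f :: "real \<Rightarrow> real"
  assumes "open S" "smooth_on S f"
  shows "x \<in> S \<Longrightarrow> (f has_real_derivative deriv f x) (at x)" "smooth_on S (deriv f)"
proof -
  from assms(2) obtain D where D: "\<forall>x\<in>S. (f has_derivative D x) (at x)"
    "\<forall>v. smooth_on S (\<lambda>x. D x v)" by (auto elim: smooth_on.cases)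
  have *: "(f has_real_derivative D x 1) (at x)" if "x \<in> S" for x
  proof -
    have "D x v = D x 1 * v" for v
      using linear_cmul[OF has_derivative_linear[OF D(1)[rule_format, OF that]], of v 1]
      by (simp only: real_scaleR_def mult_1_right mult.commute[of "D x 1" v])
    then have "D x = (*) (D x 1)" by blast
    then show ?thesis using D(1) that unfolding has_field_derivative_def by metis
  qed
  then have "deriv f x = D x 1" if "x \<in> S" for x using DERIV_imp_deriv that by blast
  then show "x \<in> S \<Longrightarrow> (f has_real_derivative deriv f x) (at x)" "smooth_on S (deriv f)"
    using * smooth_on_cong[OF assms(1), of "\<lambda>x. D x 1" "deriv f"] D(2) by auto
qed

section \<open>Elementary functions\<close>

lemma smooth_on_sin_cos: "smooth_on UNIV (sin :: real \<Rightarrow> real)" "smooth_on UNIV (cos :: real \<Rightarrow> real)"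
proof -
  \<comment> \<open>Each function is the derivative of the other up to sign, so the induction has to
    treat both at once.\<close>
  have "Ck k UNIV (sin :: real \<Rightarrow> real) \<and> Ck k UNIV (cos :: real \<Rightarrow> real)" for k
  proof (induction k)
    case 0
    then show ?case by (auto intro: continuous_intros)
  next
    case (Suc k)
    have "Ck k UNIV (\<lambda>x::real. - sin x)"
      using Suc Ck_bounded_linear_compose[OF _ bounded_linear_minus[OF bounded_linear_ident]] by blast
    with Suc show ?case
      using Ck_SucI_real[of UNIV sin cos k] Ck_SucI_real[of UNIV cos "\<lambda>x. - sin x" k]
      by (simp del: Ck.simps)
  qed
  then show "smooth_on UNIV (sin :: real \<Rightarrow> real)" "smooth_on UNIV (cos :: real \<Rightarrow> real)"
    by (auto simp: smooth_on_iff_Ck)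
qed

lemma smooth_on_inverse_real: "smooth_on (- {0}) (inverse :: real \<Rightarrow> real)"
proof -
  have o: "open (- {0 :: real})" by auto
  have "Ck k (- {0}) (inverse :: real \<Rightarrow> real)" for k
  proof (induction k)
    case 0
    then show ?case by (auto intro!: continuous_intros)
  next
    case (Suc k)
    have "Ck k (- {0}) (\<lambda>x::real. - (inverse x *\<^sub>R inverse x))"
      using Ck_bounded_linear_compose[OF o bounded_linear_minus[OF bounded_linear_ident]]
        Ck_scaleR[OF o Suc Suc] by blast
    then show ?case
      by (rule Ck_SucI_real[OF o, rotated]) (auto intro!: derivative_eq_intros)
  qed
  then show ?thesis by (simp add: smooth_on_iff_Ck[OF o])
qed

lemma smooth_on_divide:
  fixes f g :: "'a::euclidean_space \<Rightarrow> real"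
  assumes "open S" "smooth_on S f" "smooth_on S g" "\<And>x. x \<in> S \<Longrightarrow> g x \<noteq> 0"
  shows "smooth_on S (\<lambda>x. f x / g x)"
proof -
  have "smooth_on S (\<lambda>x. inverse (g x))"
    by (rule smooth_on_compose[OF assms(1) _ _ smooth_on_inverse_real assms(3)]) (use assms in auto)
  from smooth_on_mult[OF assms(1,2) this] show ?thesis by (simp add: divide_inverse)
qed

lemma smooth_on_sqrt_real: "smooth_on {0<..} sqrt"
proof -
  have o: "open {0 :: real <..}" by auto
  have "Ck k {0<..} sqrt" for k
  proof (induction k)
    case 0
    then show ?case by (auto intro!: continuous_intros)
  next
    case (Suc k)
    have "Ck k (- {0}) (inverse :: real \<Rightarrow> real)"
      using smooth_on_inverse_real by (simp add: smooth_on_iff_Ck open_Compl)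
    from Ck_scaleR[OF o Ck_compose[OF o _ _ this Suc] Ck_const[OF o, of k "1/2::real"]]
    have "Ck k {0<..} (\<lambda>x. inverse (sqrt x) / 2)" by auto
    then show ?case
      by (rule Ck_SucI_real[OF o, rotated]) (auto intro!: DERIV_real_sqrt)
  qed
  then show ?thesis by (simp add: smooth_on_iff_Ck[OF o])
qed

lemma smooth_on_sqrt:
  assumes "open S" "smooth_on S f" "\<And>x. x \<in> S \<Longrightarrow> f x > 0"
  shows "smooth_on S (\<lambda>x. sqrt (f x))"
  by (rule smooth_on_compose[OF assms(1) _ _ smooth_on_sqrt_real assms(2)]) (use assms in auto)

lemma smooth_on_sin: "open S \<Longrightarrow> smooth_on S f \<Longrightarrow> smooth_on S (\<lambda>x. sin (f x :: real))"
  by (rule smooth_on_compose[OF _ _ _ smooth_on_sin_cos(1)]) auto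

lemma smooth_on_cos: "open S \<Longrightarrow> smooth_on S f \<Longrightarrow> smooth_on S (\<lambda>x. cos (f x :: real))"
  by (rule smooth_on_compose[OF _ _ _ smooth_on_sin_cos(2)]) auto

lemma smooth_on_compose_UNIV:
  assumes "open S" "smooth_on UNIV h" "smooth_on S f"
  shows "smooth_on S (\<lambda>x. h (f x))"
  by (rule smooth_on_compose[OF assms(1) _ _ assms(2,3)]) auto

lemmas smooth_intros = smooth_on_const smooth_on_ident smooth_on_add smooth_on_diff smooth_on_uminus
  smooth_on_mult smooth_on_power smooth_on_fst smooth_on_snd smooth_on_Pair smooth_on_sin smooth_on_cos

lemma smooth_on_arcsin: "smooth_on {-1<..<1} arcsin"
proof (rule smooth_on_antiderivative[where f'="\<lambda>x. inverse (sqrt (1 - x\<^sup>2))"])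
  have "x\<^sup>2 < 1" if "x \<in> {-1<..<1}" for x :: real using that by (simp add: abs_square_less_1 abs_less_iff)
  then have "smooth_on {-1<..<1} (\<lambda>x::real. 1 / sqrt (1 - x\<^sup>2))"
    by (intro smooth_on_divide smooth_on_sqrt smooth_intros) (auto simp: less_imp_neq)
  then show "smooth_on {-1<..<1} (\<lambda>x::real. inverse (sqrt (1 - x\<^sup>2)))"
    by (simp add: divide_inverse)
qed (auto intro: DERIV_arcsin)

section \<open>The flat function \<open>exp (- 1 / t)\<close> and its derivatives\<close>

definition flat_exp :: "nat \<Rightarrow> real \<Rightarrow> real" where
  "flat_exp n t = (if t \<le> 0 then 0 else exp (- 1 / t) / t ^ n)"

lemma flat_exp_nonneg: "0 \<le> flat_exp n t"
  by (simp add: flat_exp_def)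

text \<open>The exponential beats every power of \<open>1 / t\<close>; a quadratic bound is enough
  to make the difference quotient at 0 tend to 0.\<close>

lemma flat_exp_le: "flat_exp n t \<le> real (n + 2) ^ (n + 2) * t\<^sup>2"
proof (cases "t \<le> 0")
  case False
  then have t: "t > 0" by simp
  \<comment> \<open>Of the \<open>n + 2\<close> powers of \<open>t\<close> obtained below,
    \<open>n\<close> cancel the denominator and two remain.\<close>
  define m where "m = n + 2"
  have m: "m > 0" by (simp add: m_def)
  have "1 / (real m * t) \<le> exp (1 / (real m * t))"
    using exp_ge_add_one_self[of "1 / (real m * t)"] by linarith
  then have "(1 / (real m * t)) ^ m \<le> exp (1 / (real m * t)) ^ m"
    using t by (intro power_mono) auto
  also have "\<dots> = exp (1 / t)" using m by (simp flip: exp_of_nat_mult)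
  finally have "exp (- 1 / t) \<le> (real m * t) ^ m"
    using t m by (simp add: exp_minus field_simps)
  also have "(real m * t) ^ m = real m ^ m * t\<^sup>2 * t ^ n"
    unfolding power_mult_distrib by (simp add: m_def power_add power2_eq_square)
  finally have "exp (- 1 / t) / t ^ n \<le> real m ^ m * t\<^sup>2"
    using t by (simp add: divide_le_eq)
  then show ?thesis using t by (simp add: flat_exp_def m_def)
qed (simp add: flat_exp_def)

text \<open>The family is closed under differentiation up to linear combinations, so one induction
  on the order makes all members smooth. At 0, dividing by \<open>h > 0\<close> merely raises the
  index by one, and the quadratic bound applies.\<close>

lemma flat_exp_has_derivative:
  "(flat_exp n has_real_derivative flat_exp (n + 2) t - real n * flat_exp (n + 1) t) (at t)"
proof -
  consider "t < 0" | "t = 0" | "t > 0" by linarith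
  then show ?thesis
  proof cases
    case 1
    have "((\<lambda>t. 0) has_real_derivative 0) (at t)" by simp
    then have "(flat_exp n has_real_derivative 0) (at t)"
      by (rule has_field_derivative_transform_within_open[of _ _ _ "{..<0}"])
        (use 1 in \<open>auto simp: flat_exp_def\<close>)
    then show ?thesis using 1 by (simp add: flat_exp_def)
  next
    case 2
    define C where "C = real (n + 3) ^ (n + 3)"
    have "\<bar>flat_exp n h / h\<bar> \<le> C * h\<^sup>2" for h
    proof (cases "h \<le> 0")
      case False
      then have "flat_exp n h / h = flat_exp (n + 1) h" by (simp add: flat_exp_def)
      then show ?thesis using flat_exp_le[of "n + 1" h] flat_exp_nonneg[of "n + 1" h]
        by (simp add: C_def eval_nat_numeral)
    qed (simp add: flat_exp_def C_def)
    then have bound: "\<forall>\<^sub>F h in at 0. norm (flat_exp n h / h) \<le> C * h\<^sup>2" by simp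
    have "((\<lambda>h::real. C * h\<^sup>2) \<longlongrightarrow> C * 0\<^sup>2) (at 0)"
      by (intro tendsto_intros)
    then have "((\<lambda>h. C * h\<^sup>2) \<longlongrightarrow> 0) (at 0)" by simp
    from Lim_null_comparison[OF bound this]
    have "((\<lambda>h. flat_exp n h / h) \<longlongrightarrow> 0) (at 0)" .
    then show ?thesis unfolding 2 DERIV_def by (simp add: flat_exp_def)
  next
    case 3
    have "((\<lambda>t. exp (- 1 / t) / t ^ n) has_real_derivative
        flat_exp (n + 2) t - real n * flat_exp (n + 1) t) (at t)"
    proof -
      have *: "real n * t ^ (n - Suc 0) = real n * t ^ n / t" using 3 by (cases n) auto
      show ?thesis using 3
        by (auto intro!: derivative_eq_intros simp: * flat_exp_def field_simps power2_eq_square)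
    qed
    then show ?thesis
      by (rule has_field_derivative_transform_within_open[of _ _ _ "{0<..}"])
        (use 3 in \<open>auto simp: flat_exp_def\<close>)
  qed
qed

lemma smooth_on_flat_exp: "smooth_on UNIV (flat_exp n)"
proof -
  have "\<forall>n. Ck k UNIV (flat_exp n)" for k
  proof (induction k)
    case 0
    have "isCont (flat_exp n) t" for n t
      using flat_exp_has_derivative DERIV_isCont by blast
    then show ?case by (simp add: continuous_on_eq_continuous_at)
  next
    case (Suc k)
    have "Ck k UNIV (\<lambda>t. flat_exp (n + 2) t + (- real n) *\<^sub>R flat_exp (n + 1) t)" for n
      using Suc by (intro Ck_add Ck_scaleR Ck_const) auto
    then show ?case
      by (intro allI Ck_SucI_real[where f'="\<lambda>t. flat_exp (_ + 2) t + (- real _) *\<^sub>R flat_exp (_ + 1) t"])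
        (use flat_exp_has_derivative in auto)
  qed
  then show ?thesis by (simp add: smooth_on_iff_Ck)
qed

section \<open>Smooth steps\<close>

lemma flat_exp_pos_iff: "0 < flat_exp n t \<longleftrightarrow> 0 < t"
  by (simp add: flat_exp_def)

lemma flat_exp_eq_0_iff: "flat_exp n t = 0 \<longleftrightarrow> t \<le> 0"
  by (simp add: flat_exp_def)

lemma flat_exp_0_le_1: "flat_exp 0 t \<le> 1"
  by (simp add: flat_exp_def)

definition sstep :: "real \<Rightarrow> real \<Rightarrow> real \<Rightarrow> real" where
  "sstep a b t = flat_exp 0 (t - a) / (flat_exp 0 (t - a) + flat_exp 0 (b - t))"

lemma sstep_denom_pos: "a < b \<Longrightarrow> flat_exp 0 (t - a) + flat_exp 0 (b - t) > 0"
  using flat_exp_nonneg[of 0 "t - a"] flat_exp_nonneg[of 0 "b - t"]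
    flat_exp_pos_iff[of 0 "t - a"] flat_exp_pos_iff[of 0 "b - t"] by (cases "t > a") linarith+

lemma sstep_bounds: "a < b \<Longrightarrow> 0 \<le> sstep a b t" "a < b \<Longrightarrow> sstep a b t \<le> 1"
  using sstep_denom_pos[of a b t] flat_exp_nonneg[of 0 "t - a"] flat_exp_nonneg[of 0 "b - t"]
  by (auto simp: sstep_def)

lemma sstep_eq_0: "t \<le> a \<Longrightarrow> sstep a b t = 0"
  by (simp add: sstep_def flat_exp_def)

lemma sstep_eq_1: "a < b \<Longrightarrow> b \<le> t \<Longrightarrow> sstep a b t = 1"
  by (simp add: sstep_def flat_exp_def)

lemma smooth_on_sstep: "a < b \<Longrightarrow> smooth_on UNIV (sstep a b)"
proof -
  assume "a < b"
  then have "flat_exp 0 (t - a) + flat_exp 0 (b - t) \<noteq> 0" for t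
    using sstep_denom_pos[of a b t] by simp
  then show ?thesis
    unfolding sstep_def[abs_def]
    by (intro smooth_on_divide smooth_intros smooth_on_compose_UNIV[OF _ smooth_on_flat_exp]) auto
qed

lemma deriv_sstep_nonneg: "a < b \<Longrightarrow> 0 \<le> deriv (sstep a b) t"
proof -
  assume ab: "a < b"
  have f: "(flat_exp 0 has_real_derivative flat_exp 2 t) (at t)" for t
    using flat_exp_has_derivative[of 0 t] by (simp add: numeral_2_eq_2)
  have "((\<lambda>t. flat_exp 0 (t - a)) has_real_derivative flat_exp 2 (t - a) * 1) (at t)" for t
    by (rule DERIV_chain2[OF f]) (auto intro!: derivative_eq_intros)
  then have 1: "((\<lambda>t. flat_exp 0 (t - a)) has_real_derivative flat_exp 2 (t - a)) (at t)" for t by simp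
  have "((\<lambda>t. flat_exp 0 (b - t)) has_real_derivative flat_exp 2 (b - t) * (-1)) (at t)" for t
    by (rule DERIV_chain2[OF f]) (auto intro!: derivative_eq_intros)
  then have 2: "((\<lambda>t. flat_exp 0 (b - t)) has_real_derivative - flat_exp 2 (b - t)) (at t)" for t by simp
  let ?p = "flat_exp 0 (t - a)" and ?q = "flat_exp 0 (b - t)"
  have "(sstep a b has_real_derivative
      (flat_exp 2 (t - a) * (?p + ?q) - ?p * (flat_exp 2 (t - a) + - flat_exp 2 (b - t))) / ((?p + ?q) * (?p + ?q))) (at t)"
    unfolding sstep_def[abs_def]
    using sstep_denom_pos[OF ab, of t]
    by (intro DERIV_divide DERIV_add 1 2) auto
  \<comment> \<open>Two terms of the quotient rule cancel; what remains is a sum of products of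
    nonnegative flat functions.\<close>
  then have "deriv (sstep a b) t =
      (flat_exp 2 (t - a) * ?q + ?p * flat_exp 2 (b - t)) / ((?p + ?q) * (?p + ?q))"
    by (subst DERIV_imp_deriv, assumption) (simp add: algebra_simps)
  then show ?thesis by (simp add: flat_exp_nonneg)
qed

lemma deriv_sstep_eq_0: "a < b \<Longrightarrow> t < a \<or> b < t \<Longrightarrow> deriv (sstep a b) t = 0"
proof -
  assume ab: "a < b" and t: "t < a \<or> b < t"
  have "(sstep a b has_real_derivative 0) (at t)"
  proof (cases "t < a")
    case True
    show ?thesis
      by (rule has_field_derivative_transform_within_open[of "\<lambda>_. 0" _ _ "{..<a}"])
        (use True in \<open>auto simp: sstep_eq_0\<close>)
  next
    case False
    show ?thesis
      by (rule has_field_derivative_transform_within_open[of "\<lambda>_. 1" _ _ "{b<..}"])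
        (use False t ab in \<open>auto simp: sstep_eq_1\<close>)
  qed
  then show ?thesis by (rule DERIV_imp_deriv)
qed

section \<open>Opening the punctures to slits\<close>

text \<open>The map \<open>collapse\<close> below sends the plane minus slits onto the plane minus lattice points. The slits are
  centred at the points of the lattice generated by \<open>(1,1)\<close> and \<open>(0,2)\<close>, have \<open>y\<close> constant, and consist of the
  \<open>X\<close> at which \<open>rho\<close> vanishes; their length exceeds 1, so for every \<open>X\<close> the circle \<open>X = const\<close> is cut.\<close>

definition slit_weight :: "real \<Rightarrow> real" where
  "slit_weight X = flat_exp 0 (- cos (pi * X) - 4/5)"

definition slit_prim :: "real \<Rightarrow> real" where
  "slit_prim = (SOME F. \<forall>x. (F has_real_derivative slit_weight x) (at x))"

definition slit_mass :: real where
  "slit_mass = slit_prim 2 - slit_prim 0"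

text \<open>Normalised to gain 1 over a step 2 in \<open>X\<close>, since two units of
  \<open>X\<close> will cover one period of the torus in the \<open>x\<close>-direction.\<close>

definition r0 :: "real \<Rightarrow> real" where
  "r0 X = (slit_prim X - slit_prim 0) / slit_mass"

definition rho0 :: "real \<Rightarrow> real" where
  "rho0 X = slit_weight X / slit_mass"

lemma smooth_on_slit_weight: "smooth_on UNIV slit_weight"
  unfolding slit_weight_def[abs_def]
  by (intro smooth_intros smooth_on_compose_UNIV[OF _ smooth_on_flat_exp]) auto

lemma slit_prim_has_derivative: "(slit_prim has_real_derivative slit_weight x) (at x)"
proof -
  have "isCont slit_weight x" for x
    using smooth_on_imp_continuous_on[OF smooth_on_slit_weight]
    by (simp add: continuous_on_eq_continuous_at)
  then have "\<exists>F. \<forall>x. (F has_real_derivative slit_weight x) (at x)"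
    using einterval_antiderivative[of "-\<infinity>" "\<infinity>" slit_weight]
    by (auto simp: has_real_derivative_iff_has_vector_derivative)
  from someI_ex[OF this] show ?thesis unfolding slit_prim_def by blast
qed

lemma slit_weight_nonneg: "0 \<le> slit_weight x"
  by (simp add: slit_weight_def flat_exp_nonneg)

lemma slit_prim_mono: "x \<le> y \<Longrightarrow> slit_prim x \<le> slit_prim y"
  by (rule DERIV_nonneg_imp_nondecreasing) (use slit_prim_has_derivative slit_weight_nonneg in blast)+

lemma slit_mass_pos: "slit_mass > 0"
proof (rule ccontr)
  assume "\<not> slit_mass > 0"
  then have eq: "slit_prim x = slit_prim 0" if "x \<in> {0<..<2}" for x
    using slit_prim_mono[of 0 x] slit_prim_mono[of x 2] that by (auto simp: slit_mass_def)
  have "(slit_prim has_real_derivative 0) (at 1)"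
    by (rule has_field_derivative_transform_within_open[of "\<lambda>_. slit_prim 0" _ _ "{0<..<2}"])
      (auto simp: eq)
  then have "slit_weight 1 = 0" using slit_prim_has_derivative DERIV_unique by blast
  then show False by (simp add: slit_weight_def flat_exp_eq_0_iff)
qed

lemma r0_has_derivative: "(r0 has_real_derivative rho0 x) (at x)"
  unfolding r0_def[abs_def] rho0_def
  using slit_prim_has_derivative[of x] slit_mass_pos by (auto intro!: derivative_eq_intros)

lemma smooth_on_rho0: "smooth_on UNIV rho0"
  unfolding rho0_def[abs_def]
  using slit_mass_pos by (intro smooth_on_divide smooth_on_slit_weight smooth_intros) auto

lemma smooth_on_r0: "smooth_on UNIV r0"
  by (rule smooth_on_antiderivative[OF _ r0_has_derivative smooth_on_rho0]) auto

lemma r0_0: "r0 0 = 0" and r0_2: "r0 2 = 1"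
  using slit_mass_pos by (auto simp: r0_def slit_mass_def)

lemma cos_pi_add_1: "cos (pi * (x + 1)) = - cos (pi * x)"
  and sin_pi_add_1: "sin (pi * (x + 1)) = - sin (pi * x)"
  by (simp_all add: distrib_left)

lemma rho0_add_2: "rho0 (x + 2) = rho0 x"
  using cos_pi_add_1[of "x + 1"] cos_pi_add_1[of x] by (simp add: rho0_def slit_weight_def add.assoc)

lemma rho0_nonneg: "0 \<le> rho0 x"
  using slit_mass_pos slit_weight_nonneg by (simp add: rho0_def)

lemma rho0_eq_0_iff: "rho0 x = 0 \<longleftrightarrow> - 4/5 \<le> cos (pi * x)"
  using slit_mass_pos by (auto simp: rho0_def slit_weight_def flat_exp_eq_0_iff)

lemma rho0_le: "rho0 x \<le> 1 / slit_mass"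
  using slit_mass_pos flat_exp_0_le_1 by (simp add: rho0_def slit_weight_def divide_right_mono)

lemma r0_add_2: "r0 (x + 2) = r0 x + 1"
proof -
  have "\<forall>x. ((\<lambda>x. r0 (x + 2) - r0 x) has_real_derivative 0) (at x)"
  proof
    fix x
    have "((\<lambda>x. r0 (x + 2)) has_real_derivative rho0 (x + 2)) (at x)"
      using r0_has_derivative by (simp flip: DERIV_shift)
    from DERIV_diff[OF this r0_has_derivative]
    show "((\<lambda>x. r0 (x + 2) - r0 x) has_real_derivative 0) (at x)" by (simp add: rho0_add_2)
  qed
  from DERIV_isconst_all[OF this, of x 0] show ?thesis by (simp add: r0_0 r0_2)
qed

lemma int_shift_add:
  fixes f :: "real \<Rightarrow> real"
  assumes "\<And>t. f (t + a) = f t + b"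
  shows "f (t + of_int n * a) = f t + of_int n * b"
proof (induction n rule: int_induct[where k=0])
  case (step1 i)
  then show ?case using assms[of "t + of_int i * a"] by (simp add: algebra_simps)
next
  case (step2 i)
  then show ?case using assms[of "t + of_int (i - 1) * a"] by (simp add: algebra_simps)
qed simp

lemma r0_shift: "r0 (x + of_int n * 2) = r0 x + of_int n"
  using int_shift_add[of r0 2 1 x n, OF r0_add_2] by simp

text \<open>The zeros of \<open>rho0\<close> form intervals around the even integers
  \<open>2 * n\<close>, and \<open>r0\<close> is constant on each of them with value
  \<open>n\<close>. This is why slits collapse to lattice points.\<close>

lemma r0_in_Ints:
  assumes "rho0 x = 0"
  shows "r0 x \<in> \<int>"
proof -
  define n where "n = \<lfloor>(x + 1) / 2\<rfloor>"
  define z where "z = x - of_int n * 2"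
  have "of_int n \<le> (x + 1) / 2" "(x + 1) / 2 < of_int n + 1" unfolding n_def by linarith+
  then have z: "\<bar>z\<bar> \<le> 1" unfolding z_def by (auto simp: abs_le_iff field_simps)
  have "cos (pi * z) = cos (pi * x - of_int n * (2 * pi))" by (simp add: z_def algebra_simps)
  also have "\<dots> = cos (pi * x)"
    using cos.minus_of_int[of "pi * x" n] by (simp add: mult.commute)
  finally have cz: "- 4/5 \<le> cos (pi * z)" using assms by (simp add: rho0_eq_0_iff)
  \<comment> \<open>The cosine decreases with \<open>\<bar>t\<bar>\<close> on this range, so
    everything between \<open>- \<bar>z\<bar>\<close> and \<open>\<bar>z\<bar>\<close> is a zero and
    the interval reaches the centre 0.\<close>
  have zero: "rho0 t = 0" if "\<bar>t\<bar> \<le> \<bar>z\<bar>" for t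
  proof -
    have "cos (pi * \<bar>z\<bar>) \<le> cos (pi * \<bar>t\<bar>)"
      using that z by (intro cos_monotone_0_pi_le mult_left_mono) auto
    moreover have "cos (pi * \<bar>s\<bar>) = cos (pi * s)" for s by (cases "s \<ge> 0") auto
    ultimately show ?thesis using cz by (simp add: rho0_eq_0_iff)
  qed
  have "r0 z = r0 0"
  proof -
    have "(r0 has_real_derivative 0) (at t within {- \<bar>z\<bar>..\<bar>z\<bar>})" if "t \<in> {- \<bar>z\<bar>..\<bar>z\<bar>}" for t
      using r0_has_derivative[of t] zero[of t] that
      by (auto simp: abs_le_iff intro: has_field_derivative_at_within)
    then obtain c where c: "\<And>t. t \<in> {- \<bar>z\<bar>..\<bar>z\<bar>} \<Longrightarrow> r0 t = c"
      using has_field_derivative_zero_constant[of "{- \<bar>z\<bar>..\<bar>z\<bar>}" r0] by auto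
    show ?thesis using c[of z] c[of 0] by (simp add: abs_if)
  qed
  then have "r0 x = of_int n"
    using r0_shift[of z n] by (simp add: z_def r0_0)
  then show ?thesis by simp
qed

text \<open>\<open>xi\<close> is the \<open>y\<close>-derivative of a generating function that is a trigonometric polynomial in \<open>y\<close>, so
  that the second coordinate conjugate to \<open>X\<close> (the \<open>y\<close>-integral of \<open>rho\<close>, called \<open>fibre_time\<close> later) is explicit.\<close>

definition xi :: "real \<Rightarrow> real \<Rightarrow> real" where
  "xi X y = cos (pi * y / 2) ^ 4 * r0 X + sin (pi * y / 2) ^ 4 * (r0 (X + 1) - 1/2)
    + (cos (pi * y / 2))\<^sup>2 * (sin (pi * y / 2))\<^sup>2 * X - y / 2"

definition rho :: "real \<Rightarrow> real \<Rightarrow> real" where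
  "rho X y = cos (pi * y / 2) ^ 4 * rho0 X + sin (pi * y / 2) ^ 4 * rho0 (X + 1)
    + (cos (pi * y / 2))\<^sup>2 * (sin (pi * y / 2))\<^sup>2"

definition xi_y :: "real \<Rightarrow> real \<Rightarrow> real" where
  "xi_y X y = - 2 * pi * cos (pi * y / 2) ^ 3 * sin (pi * y / 2) * r0 X
    + 2 * pi * sin (pi * y / 2) ^ 3 * cos (pi * y / 2) * (r0 (X + 1) - 1/2)
    + pi * cos (pi * y / 2) * sin (pi * y / 2) * ((cos (pi * y / 2))\<^sup>2 - (sin (pi * y / 2))\<^sup>2) * X - 1/2"

lemma cos_sin_fourth_powers: "cos t ^ 4 + sin t ^ 4 + (cos t)\<^sup>2 * (sin t)\<^sup>2 * 2 = (1::real)"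
proof -
  have "cos t ^ 4 + sin t ^ 4 + (cos t)\<^sup>2 * (sin t)\<^sup>2 * 2 = ((cos t)\<^sup>2 + (sin t)\<^sup>2)\<^sup>2" by algebra
  then show ?thesis by simp
qed

lemma xi_add_2: "xi (X + 2) y = xi X y + 1"
proof -
  have "r0 (X + 2 + 1) = r0 (X + 1) + 1" using r0_add_2[of "X + 1"] by (simp add: add_ac)
  then have "xi (X + 2) y - xi X y = cos (pi * y / 2) ^ 4 + sin (pi * y / 2) ^ 4
      + (cos (pi * y / 2))\<^sup>2 * (sin (pi * y / 2))\<^sup>2 * 2"
    unfolding xi_def by (simp add: r0_add_2 algebra_simps)
  then show ?thesis using cos_sin_fourth_powers[of "pi * y / 2"] by simp
qed

lemma half_angle_shift: "cos (pi * (y + 1) / 2) = - sin (pi * y / 2)" "sin (pi * (y + 1) / 2) = cos (pi * y / 2)"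
  using cos_add[of "pi * y / 2" "pi / 2"] sin_add[of "pi * y / 2" "pi / 2"]
  by (simp_all add: distrib_left add_divide_distrib)

text \<open>The diagonal translation exchanges the two kinds of slits. The terms
  \<open>- 1/2\<close> and \<open>- y / 2\<close> of \<open>xi\<close> are chosen so that the
  difference of both sides is half of
  \<open>(cos\<^sup>2 + sin\<^sup>2)\<^sup>2 - 1\<close>.\<close>

lemma xi_diag: "xi (X + 1) (y + 1) = xi X y"
proof -
  have r: "r0 (X + 1 + 1) = r0 X + 1" using r0_add_2[of X] by (simp add: add_ac)
  have "2 * (xi (X + 1) (y + 1) - xi X y) = cos (pi * y / 2) ^ 4 + sin (pi * y / 2) ^ 4
      + (cos (pi * y / 2))\<^sup>2 * (sin (pi * y / 2))\<^sup>2 * 2 - 1"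
    unfolding xi_def half_angle_shift r by (simp add: field_simps)
  then show ?thesis using cos_sin_fourth_powers[of "pi * y / 2"] by simp
qed

lemma rho_diag: "rho (X + 1) (y + 1) = rho X y"
  using rho0_add_2[of X] unfolding rho_def half_angle_shift by (simp add: add_ac)

text \<open>The deck group upstairs: the lattice translation \<open>(m, n)\<close> becomes
  \<open>(n + 2 * m, n)\<close> in the coordinates \<open>(X, y)\<close>. In particular
  \<open>X\<close> modulo 1 is a function on the torus.\<close>

lemma xi_shift: "xi (X + of_int n + of_int m * 2) (y + of_int n) = xi X y + of_int m"
proof -
  have "xi (X + of_int n + of_int m * 2) (y + of_int n) = xi (X + of_int n) (y + of_int n) + of_int m"
    using int_shift_add[of "\<lambda>X. xi X (y + of_int n)" 2 1 _ m, OF xi_add_2] by simp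
  also have "xi (X + of_int n) (y + of_int n) = xi X y"
    using int_shift_add[of "\<lambda>t. xi (X + t) (y + t)" 1 0 0 n] xi_diag[of "X + _" "y + _"]
    by (simp add: add_ac)
  finally show ?thesis .
qed

lemma rho_shift: "rho (X + of_int n + of_int m * 2) (y + of_int n) = rho X y"
proof -
  have "rho (X + 2) y = rho X y" for X y
    using rho0_add_2[of X] rho0_add_2[of "X + 1"] by (simp add: rho_def add_ac)
  then have "rho (X + of_int n + of_int m * 2) (y + of_int n) = rho (X + of_int n) (y + of_int n)"
    using int_shift_add[of "\<lambda>X. rho X (y + of_int n)" 2 0 _ m] by simp
  also have "\<dots> = rho X y"
    using int_shift_add[of "\<lambda>t. rho (X + t) (y + t)" 1 0 0 n] rho_diag[of "X + _" "y + _"]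
    by (simp add: add_ac)
  finally show ?thesis .
qed

lemma rho_nonneg: "0 \<le> rho X y"
  unfolding rho_def by (auto intro!: add_nonneg_nonneg mult_nonneg_nonneg rho0_nonneg)

lemma rho_even: "rho X (2 * of_int n) = rho0 X"
proof -
  have s: "sin (pi * (2 * of_int n) / 2) = 0" by (simp add: sin_integer_2pi sin_zero_iff_int2 mult.commute)
  then have "(cos (pi * (2 * of_int n) / 2))\<^sup>2 = 1" using sin_cos_squared_add[of "pi * (2 * of_int n) / 2"] by simp
  then have "cos (pi * (2 * of_int n) / 2) ^ 4 = 1"
    using power_mult[of "cos (pi * (2 * of_int n) / 2)" 2 2] by simp
  with s show ?thesis by (simp add: rho_def)
qed

lemma rho_odd: "rho X (2 * of_int n + 1) = rho0 (X + 1)"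
  using rho_diag[of "X - 1" "2 * of_int n"] rho_even[of "X - 1" n] rho0_add_2[of "X - 1"]
  by (simp add: add_ac)

lemma sin_cos_half_nonzero:
  assumes "y \<notin> \<int>"
  shows "sin (pi * y / 2) \<noteq> 0" "cos (pi * y / 2) \<noteq> 0"
proof -
  have "sin (pi * y) \<noteq> 0"
    using assms by (auto simp: sin_zero_iff_int2 mult.commute)
  moreover have "sin (pi * y) = 2 * sin (pi * y / 2) * cos (pi * y / 2)"
    using sin_double[of "pi * y / 2"] by simp
  ultimately show "sin (pi * y / 2) \<noteq> 0" "cos (pi * y / 2) \<noteq> 0" by auto
qed

lemma rho_pos: "y \<notin> \<int> \<Longrightarrow> 0 < rho X y"
  unfolding rho_def using sin_cos_half_nonzero[of y]
  by (intro add_nonneg_pos add_nonneg_nonneg mult_nonneg_nonneg mult_pos_pos rho0_nonneg) auto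

lemma xi_derivative_X: "((\<lambda>X. xi X y) has_real_derivative rho X y) (at X)"
proof -
  have "((\<lambda>x. r0 (x + 1)) has_real_derivative rho0 (X + 1)) (at X)"
    using r0_has_derivative by (simp flip: DERIV_shift)
  then show ?thesis
    unfolding xi_def rho_def by (auto intro!: derivative_eq_intros r0_has_derivative)
qed

lemma xi_has_derivative:
  "((\<lambda>p. xi (fst p) (snd p)) has_derivative
    (\<lambda>v. rho (fst p) (snd p) * fst v + xi_y (fst p) (snd p) * snd v)) (at p)"
proof -
  note [derivative_intros] = DERIV_compose_FDERIV[OF r0_has_derivative]
  show ?thesis unfolding xi_def
    apply (rule derivative_eq_intros refl | simp)+
    apply (rule ext)
    apply (simp add: rho_def xi_y_def)
    apply algebra
    done
qed

lemma smooth_on_xi: "smooth_on UNIV (\<lambda>p. xi (fst p) (snd p))"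
  and smooth_on_rho: "smooth_on UNIV (\<lambda>p. rho (fst p) (snd p))"
  and smooth_on_xi_y: "smooth_on UNIV (\<lambda>p. xi_y (fst p) (snd p))"
  unfolding xi_def rho_def xi_y_def
  by (intro smooth_intros smooth_on_divide smooth_on_compose_UNIV[OF _ smooth_on_r0]
      smooth_on_compose_UNIV[OF _ smooth_on_rho0]; simp)+

section \<open>The collapse of the slits and its smooth inverse\<close>

definition slit_plane :: "(real \<times> real) set" where
  "slit_plane = {p. 0 < rho (fst p) (snd p)}"

definition collapse :: "real \<times> real \<Rightarrow> real \<times> real" where
  "collapse p = (xi (fst p) (snd p), snd p)"

definition uncollapse :: "real \<times> real \<Rightarrow> real \<times> real" where
  "uncollapse = inv_into slit_plane collapse"

lemma open_slit_plane: "open slit_plane"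
  unfolding slit_plane_def
  using smooth_on_imp_continuous_on[OF smooth_on_rho] by (intro open_Collect_less) (auto intro: continuous_intros)

text \<open>On a line of constant \<open>y\<close>, \<open>xi\<close> never decreases in
  \<open>X\<close> and increases strictly just to the right of a point off the slits, so it cannot
  return to the same value further right.\<close>

lemma inj_on_collapse: "inj_on collapse slit_plane"
proof -
  have *: False if a: "xi X y = xi X' y" "X < X'" "0 < rho X y" for X X' y
  proof -
    have mono: "xi s y \<le> xi t y" if "s \<le> t" for s t
      by (rule DERIV_nonneg_imp_nondecreasing[OF that]) (use xi_derivative_X rho_nonneg in blast)
    obtain d where "d > 0" "\<forall>h>0. h < d \<longrightarrow> xi X y < xi (X + h) y"
      using DERIV_pos_inc_right[OF xi_derivative_X a(3)] by blast
    then have "xi X y < xi (X + min (d/2) (X' - X)) y" using a(2) by (simp add: min_def)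
    also have "\<dots> \<le> xi X' y" by (rule mono) auto
    finally show False using a(1) by simp
  qed
  show ?thesis
  proof (rule inj_onI)
    fix p q assume "p \<in> slit_plane" "q \<in> slit_plane" "collapse p = collapse q"
    then have "xi (fst p) (snd p) = xi (fst q) (snd p)" "snd p = snd q"
      "0 < rho (fst p) (snd p)" "0 < rho (fst q) (snd p)"
      by (auto simp: slit_plane_def collapse_def)
    then have "fst p = fst q" using *[of "fst p" "snd p" "fst q"] *[of "fst q" "snd p" "fst p"]
      by (metis linorder_neqE_linordered_idom)
    with \<open>snd p = snd q\<close> show "p = q" by (simp add: prod_eq_iff)
  qed
qed

text \<open>The intermediate value theorem solves for \<open>X\<close>. A solution on a slit would
  make \<open>y\<close> an integer, because \<open>rho\<close> is positive elsewhere, and then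
  \<open>x\<close> as well, because \<open>r0\<close> is integral on slits.\<close>

lemma collapse_surj:
  assumes "u \<notin> lattice 1"
  shows "u \<in> collapse ` slit_plane"
proof -
  obtain x y where u: "u = (x, y)" by fastforce
  have "xi (0 + of_int n * 2) y = xi 0 y + of_int n" for n
    using int_shift_add[of "\<lambda>X. xi X y" 2 1 0 n, OF xi_add_2] by simp
  then have shift: "xi (of_int n * 2) y = xi 0 y + of_int n" for n by simp
  define a where "a = (of_int \<lfloor>x - xi 0 y\<rfloor> * 2 :: real)"
  define b where "b = (of_int (\<lfloor>x - xi 0 y\<rfloor> + 1) * 2 :: real)"
  have "xi a y \<le> x" "x \<le> xi b y" unfolding a_def b_def shift by linarith+
  moreover have "isCont (\<lambda>X. xi X y) X" for X using xi_derivative_X DERIV_isCont by blast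
  ultimately obtain X where X: "xi X y = x"
    using IVT[of "\<lambda>X. xi X y" a x b] by (auto simp: a_def b_def)
  have "0 < rho X y"
  proof (rule ccontr)
    assume "\<not> 0 < rho X y"
    then have 0: "rho X y = 0" using rho_nonneg[of X y] by simp
    then have "y \<in> \<int>" using rho_pos[of y X] by (cases "y \<in> \<int>") auto
    then obtain k where y: "y = of_int k" by (auto elim: Ints_cases)
    define n where "n = k div 2"
    have "x \<in> \<int>"
    proof (cases "even k")
      case True
      then have y2: "y = 2 * of_int n" by (auto simp: y n_def)
      then have "rho0 X = 0" using 0 rho_even by simp
      from r0_in_Ints[OF this] have "r0 X \<in> \<int>" .
      moreover have "sin (pi * y / 2) = 0" by (simp add: y2 sin_zero_iff_int2 mult.commute)
      moreover from this have "(cos (pi * y / 2))\<^sup>2 = 1" using sin_cos_squared_add[of "pi * y / 2"] by simp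
      then have "cos (pi * y / 2) ^ 4 = 1" using power_mult[of "cos (pi * y / 2)" 2 2] by simp
      ultimately show ?thesis using X by (auto simp: xi_def y2)
    next
      case False
      then have "k = 2 * n + 1" by (simp add: n_def)
      then have y2: "y = 2 * of_int n + 1" by (simp add: y)
      then have "rho0 (X + 1) = 0" using 0 rho_odd by simp
      from r0_in_Ints[OF this] have "r0 (X + 1) \<in> \<int>" .
      moreover have "pi * y / 2 = pi * of_int n + pi / 2" by (simp add: y2 field_simps)
      then have "cos (pi * y / 2) = 0"
        by (simp only: cos_add) (simp add: sin_zero_iff_int2 mult.commute)
      moreover from this have "(sin (pi * y / 2))\<^sup>2 = 1" using sin_cos_squared_add[of "pi * y / 2"] by simp
      then have "sin (pi * y / 2) ^ 4 = 1" using power_mult[of "sin (pi * y / 2)" 2 2] by simp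
      ultimately have "x = r0 (X + 1) - of_int (n + 1)" using X by (simp add: xi_def y2 field_simps)
      then show ?thesis using \<open>r0 (X + 1) \<in> \<int>\<close> by auto
    qed
    then show False using assms y u by (auto simp: lattice_def elim!: Ints_cases)
  qed
  then have "(X, y) \<in> slit_plane" "collapse (X, y) = u"
    using X u by (auto simp: slit_plane_def collapse_def)
  then show ?thesis by force
qed

lemma continuous_on_collapse: "continuous_on S collapse"
  unfolding collapse_def[abs_def]
  using smooth_on_imp_continuous_on[OF smooth_on_xi]
  by (intro continuous_intros) (blast intro: continuous_on_subset)

lemma uncollapse_props:
  assumes "u \<notin> lattice 1"
  shows "uncollapse u \<in> slit_plane" "collapse (uncollapse u) = u"
  using collapse_surj[OF assms] by (simp_all add: uncollapse_def inv_into_into f_inv_into_f)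

text \<open>Invariance of domain supplies the continuity of the inverse that the rule for its
  derivative presupposes.\<close>

lemma collapse_image: "open (collapse ` slit_plane)" "continuous_on (collapse ` slit_plane) uncollapse"
proof -
  obtain g where g: "homeomorphism slit_plane (collapse ` slit_plane) collapse g"
    using invariance_of_domain_homeomorphism[OF open_slit_plane continuous_on_collapse _ inj_on_collapse] by auto
  show "open (collapse ` slit_plane)"
    using invariance_of_domain[OF continuous_on_collapse open_slit_plane inj_on_collapse] .
  have "g u = uncollapse u" if "u \<in> collapse ` slit_plane" for u
    using g that inj_on_collapse by (auto simp: homeomorphism_def uncollapse_def)
  then show "continuous_on (collapse ` slit_plane) uncollapse"
    using g continuous_on_eq[of _ g uncollapse] by (simp add: homeomorphism_def)
qed

lemma uncollapse_has_derivative: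
  assumes "u \<notin> lattice 1"
  shows "(uncollapse has_derivative (\<lambda>v. ((fst v - xi_y (fst (uncollapse u)) (snd (uncollapse u)) * snd v)
      / rho (fst (uncollapse u)) (snd (uncollapse u)), snd v))) (at u)"
proof (rule has_derivative_inverse_basic)
  let ?p = "uncollapse u"
  have pos: "0 < rho (fst ?p) (snd ?p)" using uncollapse_props[OF assms] by (simp add: slit_plane_def)
  show "(collapse has_derivative (\<lambda>v. (rho (fst ?p) (snd ?p) * fst v + xi_y (fst ?p) (snd ?p) * snd v, snd v))) (at ?p)"
    unfolding collapse_def[abs_def] by (intro has_derivative_Pair xi_has_derivative has_derivative_snd has_derivative_ident)
  show "bounded_linear (\<lambda>v. ((fst v - xi_y (fst ?p) (snd ?p) * snd v) / rho (fst ?p) (snd ?p), snd v))"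
    by (intro bounded_linear_Pair bounded_linear_divide[THEN bounded_linear_compose] bounded_linear_sub
        bounded_linear_mult_right[THEN bounded_linear_compose] bounded_linear_fst bounded_linear_snd)
  show "(\<lambda>v. ((fst v - xi_y (fst ?p) (snd ?p) * snd v) / rho (fst ?p) (snd ?p), snd v)) \<circ>
      (\<lambda>v. (rho (fst ?p) (snd ?p) * fst v + xi_y (fst ?p) (snd ?p) * snd v, snd v)) = id"
    using pos by (auto simp: fun_eq_iff)
  show "continuous (at u) uncollapse"
    using collapse_image collapse_surj[OF assms] continuous_on_eq_continuous_at by blast
  show "open (collapse ` slit_plane)" "u \<in> collapse ` slit_plane"
    using collapse_image collapse_surj[OF assms] by auto
  show "\<And>z. z \<in> collapse ` slit_plane \<Longrightarrow> collapse (uncollapse z) = z"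
    by (simp add: uncollapse_def f_inv_into_f)
qed

lemma lattice_1_eq: "lattice 1 = {u. sin (pi * fst u) = 0 \<and> sin (pi * snd u) = 0}"
  by (auto simp: lattice_def sin_zero_iff_int2 mult.commute[of _ pi])

lemma open_punctured: "open (UNIV - lattice 1)"
proof -
  have "closed (lattice 1)"
    unfolding lattice_1_eq by (intro closed_Collect_conj closed_Collect_eq continuous_intros)
  then show ?thesis by (simp add: Compl_eq_Diff_UNIV[symmetric] open_Compl)
qed

text \<open>Bootstrapping: the derivative of \<open>uncollapse\<close> is a smooth function
  evaluated at \<open>uncollapse\<close> itself, so every order of regularity yields the
  next.\<close>

lemma smooth_on_uncollapse: "smooth_on (UNIV - lattice 1) uncollapse"
proof -
  let ?S = "UNIV - lattice 1"
  have mem: "\<And>u. u \<in> ?S \<Longrightarrow> uncollapse u \<in> slit_plane" using uncollapse_props by auto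
  have *: "smooth_on slit_plane (\<lambda>p. (a - xi_y (fst p) (snd p) * b) / rho (fst p) (snd p))" for a b
  proof (intro smooth_on_divide smooth_intros open_slit_plane)
    show "smooth_on slit_plane (\<lambda>p. xi_y (fst p) (snd p))" "smooth_on slit_plane (\<lambda>p. rho (fst p) (snd p))"
      using smooth_on_xi_y smooth_on_rho smooth_on_subset open_slit_plane by blast+
  qed (auto simp: slit_plane_def)
  have "Ck k ?S uncollapse" for k
  proof (induction k)
    case 0
    have "continuous_on ?S uncollapse"
      by (rule continuous_on_subset[OF collapse_image(2)]) (use collapse_surj in auto)
    then show ?case by simp
  next
    case (Suc k)
    show ?case
    proof (rule Ck_SucI[OF open_punctured uncollapse_has_derivative])
      fix v :: "real \<times> real"
      have "Ck k slit_plane (\<lambda>p. ((fst v - xi_y (fst p) (snd p) * snd v) / rho (fst p) (snd p)))"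
        using *[of "fst v" "snd v"] smooth_on_iff_Ck open_slit_plane by blast
      from Ck_compose[OF open_punctured open_slit_plane mem this Suc]
      show "Ck k ?S (\<lambda>u. ((fst v - xi_y (fst (uncollapse u)) (snd (uncollapse u)) * snd v)
          / rho (fst (uncollapse u)) (snd (uncollapse u)), snd v))"
        by (intro Ck_Pair Ck_const open_punctured)
    qed auto
  qed
  then show ?thesis using smooth_on_iff_Ck[OF open_punctured] by blast
qed

lemma uncollapse_shift:
  assumes "u \<notin> lattice 1"
  shows "uncollapse (u + (of_int m, of_int n)) = uncollapse u + (of_int n + of_int m * 2, of_int n)"
proof -
  let ?p = "uncollapse u + (of_int n + of_int m * 2, of_int n)"
  have "rho (fst ?p) (snd ?p) = rho (fst (uncollapse u)) (snd (uncollapse u))"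
    using rho_shift[of "fst (uncollapse u)" n m "snd (uncollapse u)"] by (simp add: add_ac)
  then have "?p \<in> slit_plane" using uncollapse_props(1)[OF assms] by (simp add: slit_plane_def)
  moreover have "collapse ?p = u + (of_int m, of_int n)"
    using xi_shift[of "fst (uncollapse u)" n m "snd (uncollapse u)"] uncollapse_props(2)[OF assms]
    by (auto simp: collapse_def prod_eq_iff add_ac)
  ultimately show ?thesis using inv_into_f_f[OF inj_on_collapse] by (metis uncollapse_def)
qed

section \<open>The immersed annulus\<close>

text \<open>The mean of \<open>rho X\<close> over a period 2 in \<open>y\<close>. The rest of
  \<open>rho\<close> has mean zero, and \<open>osc\<close> is its periodic primitive that vanishes
  at integers.\<close>

definition half_period :: "real \<Rightarrow> real" where
  "half_period X = 3/8 * (rho0 X + rho0 (X + 1)) + 1/8"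

definition osc :: "real \<Rightarrow> real \<Rightarrow> real" where
  "osc X y = (rho0 X - rho0 (X + 1)) * sin (pi * y) / (2 * pi)
    + (rho0 X + rho0 (X + 1) - 1) * sin (2 * pi * y) / (16 * pi)"

definition fibre_time :: "real \<Rightarrow> real \<Rightarrow> real" where
  "fibre_time X y = osc X y + half_period X * y"

text \<open>\<open>saw\<close> jumps at odd \<open>y\<close>, \<open>saw (y - 1)\<close> at even \<open>y\<close>. On the slit plane the jumps of \<open>height\<close> always lie on
  slits; where both kinds of slits are present there are two sheets, and \<open>lam\<close> lets them cross.\<close>

definition saw :: "real \<Rightarrow> real" where
  "saw y = y - 2 * of_int \<lfloor>(y + 1) / 2\<rfloor>"

definition lam :: "real \<Rightarrow> real" where
  "lam X = sstep (-1/3) (1/3) (- cos (pi * X))"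

definition height :: "real \<Rightarrow> real \<Rightarrow> real" where
  "height X y = osc X y + half_period X * ((1 - lam X) * saw (y - 1) + lam X * saw y)"

lemma rho_eq_double_angle:
  "rho X y = (rho0 X - rho0 (X + 1)) * cos (pi * y) / 2
    + (rho0 X + rho0 (X + 1) - 1) * cos (2 * pi * y) / 8 + half_period X"
proof -
  let ?C = "cos (pi * y)"
  have c: "(cos (pi * y / 2))\<^sup>2 = (1 + ?C) / 2" using cos_double_cos[of "pi * y / 2"] by simp
  have s: "(sin (pi * y / 2))\<^sup>2 = (1 - ?C) / 2" using cos_double_sin[of "pi * y / 2"] by simp
  have c2: "cos (2 * pi * y) = 2 * ?C\<^sup>2 - 1" using cos_double_cos[of "pi * y"] by (simp add: mult_ac)
  have "cos (pi * y / 2) ^ 4 = ((1 + ?C) / 2)\<^sup>2" "sin (pi * y / 2) ^ 4 = ((1 - ?C) / 2)\<^sup>2"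
    using power_mult[of "cos (pi * y / 2)" 2 2] power_mult[of "sin (pi * y / 2)" 2 2] by (simp_all add: c s)
  then show ?thesis unfolding rho_def half_period_def c s c2
    by (simp only:) (simp add: power2_eq_square field_simps)
qed

text \<open>This makes \<open>fibre_time\<close> conjugate to \<open>X\<close>: the area form pulls
  back under \<open>collapse\<close> to \<open>rho\<close> times \<open>dX \<and> dy\<close>, which
  is \<open>dX \<and> d(fibre_time)\<close>.\<close>

lemma fibre_time_derivative: "(fibre_time X has_real_derivative rho X y) (at y)"
  unfolding fibre_time_def[abs_def] osc_def rho_eq_double_angle
  by (rule derivative_eq_intros refl | simp add: field_simps)+

lemma fibre_time_strict_mono:
  assumes "-1 \<le> a" "a < b" "b \<le> 1"
  shows "fibre_time X a < fibre_time X b"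
proof -
  \<comment> \<open>Positivity of \<open>rho\<close> is known off the integers only, so the interval
    is cut at 0, the one integer it can contain in its interior.\<close>
  have *: "fibre_time X a < fibre_time X b" if "a < b" "\<And>t. a < t \<Longrightarrow> t < b \<Longrightarrow> t \<notin> \<int>" for a b
    by (rule DERIV_pos_imp_increasing_open[OF that(1)])
      (use fibre_time_derivative rho_pos that(2) in
        \<open>blast intro: DERIV_isCont continuous_at_imp_continuous_on\<close>)+
  have nI: "t \<notin> \<int>" if "of_int n < t" "t < of_int n + 1" for t :: real and n
    using that by (auto elim!: Ints_cases)
  consider "b \<le> 0" | "a \<ge> 0" | "a < 0" "b > 0" by linarith
  then show ?thesis
  proof cases
    case 1
    show ?thesis by (rule *[OF assms(2)], rule nI[of "-1"]) (use 1 assms in auto)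
  next
    case 2
    show ?thesis by (rule *[OF assms(2)], rule nI[of 0]) (use 2 assms in auto)
  next
    case 3
    have "fibre_time X a < fibre_time X 0" by (rule *[OF 3(1)], rule nI[of "-1"]) (use 3 assms in auto)
    also have "\<dots> < fibre_time X b" by (rule *[OF 3(2)], rule nI[of 0]) (use 3 assms in auto)
    finally show ?thesis .
  qed
qed

lemma fibre_time_inj:
  "a \<in> {-1..1} \<Longrightarrow> b \<in> {-1..1} \<Longrightarrow> fibre_time X a = fibre_time X b \<Longrightarrow> a = b"
  using fibre_time_strict_mono[of a b X] fibre_time_strict_mono[of b a X] by (force simp: not_less)

lemma fibre_time_pos_iff: "t \<in> {-1..1} \<Longrightarrow> 0 < fibre_time X t \<longleftrightarrow> 0 < t"
  and fibre_time_neg_iff: "t \<in> {-1..1} \<Longrightarrow> fibre_time X t < 0 \<longleftrightarrow> t < 0"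
proof -
  have 0: "fibre_time X 0 = 0" by (simp add: fibre_time_def osc_def)
  assume "t \<in> {-1..1}"
  then show "0 < fibre_time X t \<longleftrightarrow> 0 < t" "fibre_time X t < 0 \<longleftrightarrow> t < 0"
    using fibre_time_strict_mono[of 0 t X] fibre_time_strict_mono[of t 0 X] 0
    by (auto, (cases t "0::real" rule: linorder_cases; force)+)
qed

section \<open>Sawtooths and invariance under the deck group\<close>

lemma saw_bounds: "-1 \<le> saw y" "saw y < 1"
proof -
  have "of_int \<lfloor>(y + 1) / 2\<rfloor> \<le> (y + 1) / 2" "(y + 1) / 2 < of_int \<lfloor>(y + 1) / 2\<rfloor> + 1" by linarith+
  then show "-1 \<le> saw y" "saw y < 1" unfolding saw_def by (auto simp: field_simps)
qed

lemma saw_eqI: "2 * of_int n - 1 \<le> y \<Longrightarrow> y < 2 * of_int n + 1 \<Longrightarrow> saw y = y - 2 * of_int n"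
proof -
  assume "2 * of_int n - 1 \<le> y" "y < 2 * of_int n + 1"
  then have "\<lfloor>(y + 1) / 2\<rfloor> = n" by (intro floor_unique) auto
  then show ?thesis by (simp add: saw_def)
qed

lemma saw_add_2: "saw (y + 2) = saw y"
proof -
  have "saw (y + 2) = y + 2 - 2 * of_int (\<lfloor>(y + 1) / 2\<rfloor> + 1)"
    by (rule saw_eqI) (use saw_bounds[of y] in \<open>auto simp: saw_def\<close>)
  then show ?thesis by (simp add: saw_def)
qed

lemma saw_decomp: obtains n :: int where "y = saw y + 2 * of_int n"
  using that[of "\<lfloor>(y + 1) / 2\<rfloor>"] by (simp add: saw_def)

lemma saw_minus_1_pos: "0 \<le> saw y \<Longrightarrow> saw (y - 1) = saw y - 1"
proof -
  assume *: "0 \<le> saw y"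
  obtain n where n: "y = saw y + 2 * of_int n" by (rule saw_decomp)
  have "saw (y - 1) = y - 1 - 2 * of_int n"
    by (rule saw_eqI) (use saw_bounds[of y] n * in auto)
  then show ?thesis using n by simp
qed

lemma saw_minus_1_neg: "saw y < 0 \<Longrightarrow> saw (y - 1) = saw y + 1"
proof -
  assume *: "saw y < 0"
  obtain n where n: "y = saw y + 2 * of_int n" by (rule saw_decomp)
  have "saw (y - 1) = y - 1 - 2 * of_int (n - 1)"
    by (rule saw_eqI) (use saw_bounds[of y] n * in auto)
  then show ?thesis using n by simp
qed

lemma int_periodic:
  fixes f :: "real \<Rightarrow> real"
  assumes "\<And>t. f (t + a) = f t"
  shows "f (t + of_int n * a) = f t"
  using int_shift_add[of f a 0 t n] assms by simp

text \<open>The two hypotheses concern generators of the deck group: \<open>(n + 2 * m, n)\<close>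
  is \<open>n + 2 * m\<close> times \<open>(1, 1)\<close> minus \<open>m\<close> times
  \<open>(0, 2)\<close>.\<close>

lemma slit_invariant:
  fixes F :: "real \<Rightarrow> real \<Rightarrow> real"
  assumes "\<And>X y. F (X + 1) (y + 1) = F X y" "\<And>X y. F X (y + 2) = F X y"
  shows "F (X + of_int n + of_int m * 2) (y + of_int n) = F X y"
proof -
  have "F (X + of_int (n + 2 * m)) (y - of_int m * 2 + of_int (n + 2 * m)) = F X (y - of_int m * 2)"
    using int_periodic[of "\<lambda>t. F (X + t) (y - of_int m * 2 + t)" 1 0 "n + 2 * m"] assms(1)
    by (simp add: add.assoc[symmetric])
  also have "\<dots> = F X y"
    using int_periodic[of "F X" 2 y "- m", OF assms(2)] by simp
  finally show ?thesis by (simp add: algebra_simps)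
qed

lemma sin_pi_add_2: "sin (pi * (y + 2)) = sin (pi * y)" and cos_pi_add_2: "cos (pi * (y + 2)) = cos (pi * y)"
  and sin_2pi_add_1: "sin (2 * pi * (y + 1)) = sin (2 * pi * y)"
  using sin_pi_add_1[of "y + 1"] sin_pi_add_1[of y] cos_pi_add_1[of "y + 1"] cos_pi_add_1[of y]
    sin_pi_add_1[of "2 * y"] sin_pi_add_1[of "2 * y + 1"]
  by (simp_all add: add.assoc) (simp add: algebra_simps)

lemma osc_diag: "osc (X + 1) (y + 1) = osc X y"
proof -
  have "(rho0 (X + 1) - rho0 X) * - sin (pi * y) = (rho0 X - rho0 (X + 1)) * sin (pi * y)"
    by (simp add: algebra_simps)
  then show ?thesis
    using rho0_add_2[of X] by (simp add: osc_def sin_pi_add_1 sin_2pi_add_1 add.assoc add.commute[of "rho0 X"])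
qed

lemma osc_add_2: "osc X (y + 2) = osc X y"
  using sin_2pi_add_1[of "y + 1"] by (simp add: osc_def sin_pi_add_2 sin_2pi_add_1 add.assoc)

lemma half_period_add_1: "half_period (X + 1) = half_period X"
  using rho0_add_2[of X] by (simp add: half_period_def add.assoc)

lemma lam_add_1: "lam (X + 1) = 1 - lam X"
proof -
  let ?w = "cos (pi * X)"
  have "flat_exp 0 (- ?w - - 1 / 3) + flat_exp 0 (1 / 3 - - ?w) > 0" by (rule sstep_denom_pos) simp
  then show ?thesis
    unfolding lam_def sstep_def cos_pi_add_1 by (simp add: field_simps)
qed

lemma lam_eq_0: "1/3 \<le> cos (pi * X) \<Longrightarrow> lam X = 0"
  and lam_eq_1: "cos (pi * X) \<le> -1/3 \<Longrightarrow> lam X = 1"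
  by (auto simp: lam_def sstep_eq_0 sstep_eq_1)

lemma lam_bounds: "0 \<le> lam X" "lam X \<le> 1"
  by (auto simp: lam_def sstep_bounds)

text \<open>The diagonal translation interchanges the two sawtooths and at the same time
  \<open>lam\<close> and \<open>1 - lam\<close>.\<close>

lemma height_diag: "height (X + 1) (y + 1) = height X y"
proof -
  have "saw (y + 1) = saw (y - 1)" using saw_add_2[of "y - 1"] by (simp add: add.commute)
  then show ?thesis by (simp add: height_def osc_diag half_period_add_1 lam_add_1)
qed

lemma height_add_2: "height X (y + 2) = height X y"
proof -
  have "saw (y + 2 - 1) = saw (y - 1)" using saw_add_2[of "y - 1"] by (simp add: algebra_simps)
  then show ?thesis by (simp only: height_def osc_add_2 saw_add_2)
qed

lemma osc_saw: "osc X (saw y) = osc X y"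
proof -
  obtain n where "y = saw y + 2 * of_int n" by (rule saw_decomp)
  then show ?thesis using int_periodic[of "osc X" 2 "saw y" n, OF osc_add_2] by (simp add: mult.commute)
qed

lemma sin_saw: "sin (pi * saw y) = sin (pi * y)"
proof -
  obtain n where "y = saw y + 2 * of_int n" by (rule saw_decomp)
  then show ?thesis using int_periodic[of "\<lambda>y. sin (pi * y)" 2 "saw y" n, OF sin_pi_add_2] by (simp add: mult.commute)
qed

lemma sin_pi_pos_iff: "y \<notin> \<int> \<Longrightarrow> 0 < sin (pi * y) \<longleftrightarrow> 0 < saw y"
  and sin_pi_neg_iff: "y \<notin> \<int> \<Longrightarrow> sin (pi * y) < 0 \<longleftrightarrow> saw y < 0"
proof -
  assume y: "y \<notin> \<int>"
  have ne: "saw y \<noteq> 0" "saw y \<noteq> -1"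
    using y saw_decomp[of y]
    by (metis Ints_1 Ints_add Ints_minus Ints_mult Ints_numeral Ints_of_int add_0)+
  have pos: "0 < sin (pi * t)" if "0 < t" "t < 1" for t
    using that by (intro sin_gt_zero) auto
  have "0 < sin (pi * saw y)" if "0 < saw y" using pos[OF that saw_bounds(2)] .
  moreover have "sin (pi * saw y) < 0" if "saw y < 0"
    using pos[of "- saw y"] that saw_bounds(1)[of y] ne(2) by auto
  ultimately show "0 < sin (pi * y) \<longleftrightarrow> 0 < saw y" "sin (pi * y) < 0 \<longleftrightarrow> saw y < 0"
    using ne(1) unfolding sin_saw by (auto, (cases "saw y" "0::real" rule: linorder_cases; force)+)
qed

text \<open>On this side of the crossing a single sawtooth is active. Arguments about the opposite
  sign of the cosine are brought here by the diagonal translation.\<close>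

lemma height_lam_1: "cos (pi * X) \<le> -1/3 \<Longrightarrow> height X y = fibre_time X (saw y)"
  by (simp add: height_def lam_eq_1 fibre_time_def osc_saw)

section \<open>The annulus in symplectic polar coordinates\<close>

definition hbound :: real where
  "hbound = 10 / slit_mass + 10"

lemma hbound_ge: "10 \<le> hbound"
  using slit_mass_pos by (simp add: hbound_def)

lemma height_bound: "\<bar>height X y\<bar> \<le> hbound"
proof -
  define M where "M = 1 / slit_mass"
  have r: "0 \<le> rho0 X" "rho0 X \<le> M" "0 \<le> rho0 (X + 1)" "rho0 (X + 1) \<le> M"
    using rho0_nonneg rho0_le by (auto simp: M_def)
  have pi1: "1 \<le> 2 * pi" "1 \<le> 16 * pi" using pi_gt3 by auto
  have le: "\<bar>a * s / c\<bar> \<le> b" if "\<bar>a\<bar> \<le> b" "\<bar>s\<bar> \<le> 1" "1 \<le> c" for a b c s :: real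
  proof -
    have "\<bar>a * s / c\<bar> \<le> \<bar>a\<bar> * \<bar>s\<bar> / 1"
      unfolding abs_divide abs_mult using that by (intro frac_le) auto
    also have "\<dots> \<le> b * 1" unfolding div_by_1 using that by (intro mult_mono) auto
    finally show ?thesis by simp
  qed
  have "\<bar>(rho0 X - rho0 (X + 1)) * sin (pi * y) / (2 * pi)\<bar> \<le> M"
    by (rule le) (use r pi1 in auto)
  moreover have "\<bar>(rho0 X + rho0 (X + 1) - 1) * sin (2 * pi * y) / (16 * pi)\<bar> \<le> 2 * M + 1"
    by (rule le) (use r pi1 in auto)
  ultimately have 1: "\<bar>osc X y\<bar> \<le> 3 * M + 1" unfolding osc_def by linarith
  have "\<bar>saw y\<bar> \<le> 1" "\<bar>saw (y - 1)\<bar> \<le> 1" using saw_bounds[of y] saw_bounds[of "y - 1"] by auto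
  then have "\<bar>(1 - lam X) * saw (y - 1) + lam X * saw y\<bar> \<le> (1 - lam X) * 1 + lam X * 1"
    using lam_bounds[of X] by (intro order_trans[OF abs_triangle_ineq] add_mono) (auto simp: abs_mult intro!: mult_left_le)
  moreover have "0 \<le> half_period X" "half_period X \<le> M + 1"
    using r by (simp_all add: half_period_def field_simps)
  then have "\<bar>half_period X\<bar> \<le> M + 1" by simp
  ultimately have "\<bar>half_period X * ((1 - lam X) * saw (y - 1) + lam X * saw y)\<bar> \<le> (M + 1) * 1"
    unfolding abs_mult by (intro mult_mono) auto
  with 1 have "\<bar>height X y\<bar> \<le> 3 * M + 1 + (M + 1) * 1"
    unfolding height_def by (intro order_trans[OF abs_triangle_ineq] add_mono)
  also have "\<dots> \<le> hbound" using r by (simp add: hbound_def M_def)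
  finally show ?thesis .
qed

text \<open>Division by \<open>pi\<close> matches the angle \<open>pi - 2 * pi * X\<close>: half of
  \<open>d(sqradius) \<and> d(angle)\<close> equals \<open>dX \<and> d(height)\<close>. The offset
  \<open>9 + hbound\<close> keeps the radius above 3.\<close>

definition sqradius :: "real \<Rightarrow> real \<Rightarrow> real" where
  "sqradius X y = 9 + hbound + height X y / pi"

text \<open>The annulus \<open>(X mod 1, height)\<close> is wrapped around the origin of the \<open>(P,Q)\<close>-plane in symplectic polar
  coordinates. The sheets are separated for \<open>P > 0\<close> and cross only for \<open>P > 2\<close>; there the sign of \<open>side\<close>
  tells them apart.\<close>

definition cP :: "real \<Rightarrow> real \<Rightarrow> real" where
  "cP X y = sqrt (sqradius X y) * cos (pi - 2 * pi * X)"

definition cQ :: "real \<Rightarrow> real \<Rightarrow> real" where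
  "cQ X y = sqrt (sqradius X y) * sin (pi - 2 * pi * X)"

definition side :: "real \<Rightarrow> real \<Rightarrow> real" where
  "side X y = sin (pi * X) * sin (pi * y)"

definition rmax :: real where
  "rmax = 10 + 2 * hbound"

lemma sqradius_bounds: "9 < sqradius X y" "sqradius X y < rmax\<^sup>2"
proof -
  have "\<bar>height X y / pi\<bar> \<le> \<bar>height X y\<bar> / 3"
    unfolding abs_divide using pi_gt3 by (intro divide_left_mono) auto
  then have "\<bar>height X y / pi\<bar> < hbound" using height_bound[of X y] hbound_ge by linarith
  then show "9 < sqradius X y" unfolding sqradius_def by linarith
  have "sqradius X y < rmax" using \<open>\<bar>height X y / pi\<bar> < hbound\<close> hbound_ge unfolding sqradius_def rmax_def by linarith
  also have "rmax \<le> rmax\<^sup>2" using hbound_ge by (intro self_le_power) (auto simp: rmax_def)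
  finally show "sqradius X y < rmax\<^sup>2" .
qed

lemma radius_bounds: "3 < sqrt (sqradius X y)" "sqrt (sqradius X y) < rmax"
proof -
  have "sqrt (3\<^sup>2) < sqrt (sqradius X y)" "sqrt (sqradius X y) < sqrt (rmax\<^sup>2)"
    using sqradius_bounds[of X y] by (subst real_sqrt_less_iff; simp)+
  then show "3 < sqrt (sqradius X y)" "sqrt (sqradius X y) < rmax"
    using hbound_ge by (auto simp: rmax_def)
qed

lemma cP_cQ_sqradius: "(cP X y)\<^sup>2 + (cQ X y)\<^sup>2 = sqradius X y"
proof -
  have "(cP X y)\<^sup>2 + (cQ X y)\<^sup>2 = (sqrt (sqradius X y))\<^sup>2 * ((cos (pi - 2 * pi * X))\<^sup>2 + (sin (pi - 2 * pi * X))\<^sup>2)"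
    unfolding cP_def cQ_def by (simp only: power_mult_distrib distrib_left)
  then show ?thesis using sqradius_bounds(1)[of X y] by (simp only: sin_cos_squared_add2) simp
qed

lemma cP_eq: "cP X y = sqrt (sqradius X y) * (1 - 2 * (cos (pi * X))\<^sup>2)"
  using cos_double_cos[of "pi * X"] by (simp add: cP_def mult_ac)

lemma cQ_eq: "cQ X y = 2 * sqrt (sqradius X y) * sin (pi * X) * cos (pi * X)"
  using sin_double[of "pi * X"] by (simp add: cQ_def mult_ac)

lemma cP_bound: "\<bar>cP X y\<bar> < rmax" and cQ_bound: "\<bar>cQ X y\<bar> < rmax"
proof -
  have "\<bar>sqrt (sqradius X y)\<bar> = sqrt (sqradius X y)" "0 \<le> sqrt (sqradius X y)"
    using sqradius_bounds(1)[of X y] by auto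
  then have "\<bar>cP X y\<bar> \<le> sqrt (sqradius X y) * 1" "\<bar>cQ X y\<bar> \<le> sqrt (sqradius X y) * 1"
    unfolding cP_def cQ_def abs_mult by (auto intro!: mult_left_le)
  then show "\<bar>cP X y\<bar> < rmax" "\<bar>cQ X y\<bar> < rmax" using radius_bounds(2)[of X y] by linarith+
qed

lemma shift_invariants:
  "height (X + of_int n + of_int m * 2) (y + of_int n) = height X y"
  "cP (X + of_int n + of_int m * 2) (y + of_int n) = cP X y"
  "cQ (X + of_int n + of_int m * 2) (y + of_int n) = cQ X y"
  "side (X + of_int n + of_int m * 2) (y + of_int n) = side X y"
proof -
  have [simp]: "sqradius (X + 1) (y + 1) = sqradius X y" "sqradius X (y + 2) = sqradius X y" for X y
    by (simp_all add: sqradius_def height_diag height_add_2)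
  show "height (X + of_int n + of_int m * 2) (y + of_int n) = height X y"
    "cP (X + of_int n + of_int m * 2) (y + of_int n) = cP X y"
    "cQ (X + of_int n + of_int m * 2) (y + of_int n) = cQ X y"
    "side (X + of_int n + of_int m * 2) (y + of_int n) = side X y"
    by (rule slit_invariant; simp add: height_diag height_add_2 cP_eq cQ_eq side_def
      sin_pi_add_1 cos_pi_add_1 sin_pi_add_2 cos_pi_add_2)+
qed

text \<open>The bound 1/2 lies below \<open>(4/5)\<^sup>2\<close>, so for \<open>P > 0\<close> slits
  of both kinds cut the circle and it falls into two sheets.\<close>

lemma cP_pos_imp:
  assumes "0 < cP X y"
  shows "(cos (pi * X))\<^sup>2 < 1/2" "sin (pi * X) \<noteq> 0" "rho0 X = 0" "rho0 (X + 1) = 0"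
proof -
  show *: "(cos (pi * X))\<^sup>2 < 1/2"
    using assms sqradius_bounds(1)[of X y] unfolding cP_eq by (auto simp: zero_less_mult_iff)
  show "sin (pi * X) \<noteq> 0"
  proof
    assume "sin (pi * X) = 0"
    then have "(cos (pi * X))\<^sup>2 = 1"
      using sin_zero_abs_cos_one[of "pi * X"] by (metis one_power2 power2_abs)
    with * show False by simp
  qed
  have "\<bar>cos (pi * X)\<bar> \<le> 4/5"
    by (rule power2_le_imp_le) (use * in \<open>auto simp: power2_eq_square\<close>)
  then show "rho0 X = 0" "rho0 (X + 1) = 0" by (auto simp: rho0_eq_0_iff cos_pi_add_1)
qed

lemma cP_pos_imp_not_int:
  assumes "0 < cP X y" "(X, y) \<in> slit_plane"
  shows "y \<notin> \<int>"
proof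
  assume "y \<in> \<int>"
  then obtain k where y: "y = of_int k" by (auto elim: Ints_cases)
  have "rho X y = 0"
  proof (cases "even k")
    case True
    then have "y = 2 * of_int (k div 2)" by (auto simp: y)
    then show ?thesis using rho_even cP_pos_imp[OF assms(1)] by simp
  next
    case False
    then have "k = 2 * (k div 2) + 1" by simp
    then have "y = 2 * of_int (k div 2) + 1" unfolding y by (metis of_int_1 of_int_add of_int_mult of_int_numeral)
    then show ?thesis using rho_odd cP_pos_imp[OF assms(1)] by simp
  qed
  with assms(2) show False by (simp add: slit_plane_def)
qed

text \<open>The radius exceeds 3, and a squared cosine of at most 1/8 makes the other factor of
  \<open>cP\<close> at least 3/4; this is the origin of 9/4. As 1/8 exceeds 1/9, the zone where
  \<open>lam\<close> varies is avoided.\<close>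

lemma cP_low_imp:
  assumes "cP X y < 9/4"
  shows "1/3 < \<bar>cos (pi * X)\<bar>"
proof -
  have "1/8 < (cos (pi * X))\<^sup>2"
  proof (rule ccontr)
    assume "\<not> ?thesis"
    then have "3/4 \<le> 1 - 2 * (cos (pi * X))\<^sup>2" by simp
    then have "3 * (3/4) \<le> cP X y" unfolding cP_eq using radius_bounds(1)[of X y] sqradius_bounds(1)[of X y]
      by (intro mult_mono) auto
    with assms show False by simp
  qed
  then have "(1/3)\<^sup>2 < \<bar>cos (pi * X)\<bar>\<^sup>2" by (simp add: power2_eq_square)
  then show ?thesis by (rule power2_less_imp_less) auto
qed

lemma side_nonzero:
  assumes "0 < cP X y" "(X, y) \<in> slit_plane"
  shows "side X y \<noteq> 0"
proof -
  have "sin (pi * y) \<noteq> 0"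
    using cP_pos_imp_not_int[OF assms] by (auto simp: sin_zero_iff_int2 mult.commute)
  then show ?thesis using cP_pos_imp[OF assms(1)] by (simp add: side_def)
qed

lemma shift_slit_plane: "(X, y) \<in> slit_plane \<Longrightarrow> (X + of_int n + of_int m * 2, y + of_int n) \<in> slit_plane"
  by (simp add: slit_plane_def rho_shift)

text \<open>The crossing exchanges the heights of the sheets, and \<open>Q\<close> changes sign with
  it. Hence the sheet with positive \<open>side\<close> is the inner one for \<open>Q > 0\<close>
  and the outer one for \<open>Q < 0\<close>: in both halves it is the one with smaller
  \<open>Q\<close>, as \<open>bulge_mono\<close> requires.\<close>

lemma side_pos_iff:
  assumes "0 < cP X y" "cP X y < 9/4" "(X, y) \<in> slit_plane"
  shows "0 < side X y \<longleftrightarrow> cQ X y * height X y < 0" "cQ X y \<noteq> 0"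
proof -
  have *: "(0 < side X y \<longleftrightarrow> cQ X y * height X y < 0) \<and> cQ X y \<noteq> 0"
    if w: "cos (pi * X) < -1/3" and P: "0 < cP X y" and sl: "(X, y) \<in> slit_plane" for X y
  proof -
    have ni: "y \<notin> \<int>" using cP_pos_imp_not_int[OF P sl] .
    define r where "r = 2 * sqrt (sqradius X y) * - cos (pi * X)"
    have r: "r > 0" unfolding r_def using sqradius_bounds(1)[of X y] w by (intro mult_pos_pos) auto
    have Q: "cQ X y = - (r * sin (pi * X))" by (simp add: cQ_eq r_def)
    have h: "0 < height X y \<longleftrightarrow> 0 < sin (pi * y)" "height X y < 0 \<longleftrightarrow> sin (pi * y) < 0"
      using saw_bounds[of y] w by (simp_all add: height_lam_1 fibre_time_pos_iff fibre_time_neg_iff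
          sin_pi_pos_iff[OF ni] sin_pi_neg_iff[OF ni])
    have "cQ X y * height X y < 0 \<longleftrightarrow> 0 < r * (sin (pi * X) * height X y)" unfolding Q by (simp add: mult_ac)
    also have "\<dots> \<longleftrightarrow> 0 < sin (pi * X) * height X y" using r by (simp add: zero_less_mult_iff)
    also have "\<dots> \<longleftrightarrow> 0 < side X y" unfolding side_def zero_less_mult_iff h ..
    finally show ?thesis using Q r cP_pos_imp[OF P] by simp
  qed
  have w: "1/3 < \<bar>cos (pi * X)\<bar>" by (rule cP_low_imp[OF assms(2)])
  have "(0 < side X y \<longleftrightarrow> cQ X y * height X y < 0) \<and> cQ X y \<noteq> 0"
  proof (cases "cos (pi * X) < 0")
    case True
    then show ?thesis using *[of X y] w assms by auto
  next
    case False
    then have "cos (pi * (X + 1)) < - 1/3" using w by (simp add: cos_pi_add_1)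
    then show ?thesis
      using *[of "X + 1" "y + 1"] shift_invariants[of X 1 0 y] shift_slit_plane[of X y 1 0] assms by simp
  qed
  then show "0 < side X y \<longleftrightarrow> cQ X y * height X y < 0" "cQ X y \<noteq> 0" by auto
qed

text \<open>Both alternatives reduce to injectivity of \<open>fibre_time\<close> on one period: away
  from the crossing only one sawtooth is active, and on a common sheet the two sawtooths differ by
  the same constant.\<close>

lemma height_inj:
  assumes "height X y = height X y'"
    "1/3 < \<bar>cos (pi * X)\<bar> \<or> (y \<notin> \<int> \<and> y' \<notin> \<int> \<and> (0 < sin (pi * y) \<longleftrightarrow> 0 < sin (pi * y')))"
  shows "\<exists>j::int. y' = y + 2 * of_int j"
proof -
  have saw: "\<exists>j::int. y' = y + 2 * of_int j" if "saw y = saw y'" for y y'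
  proof -
    obtain n n' where "y = saw y + 2 * of_int n" "y' = saw y' + 2 * of_int n'"
      using saw_decomp[of y] saw_decomp[of y'] by metis
    then have "y' = y + 2 * of_int (n' - n)" using that by simp
    then show ?thesis by blast
  qed
  have neg: "\<exists>j::int. y' = y + 2 * of_int j" if "cos (pi * X) < -1/3" "height X y = height X y'" for X y y'
  proof -
    have "fibre_time X (saw y) = fibre_time X (saw y')" using that by (simp add: height_lam_1)
    then show ?thesis using saw fibre_time_inj[of "saw y" "saw y'" X] saw_bounds[of y] saw_bounds[of y'] by auto
  qed
  consider "cos (pi * X) < -1/3" | "cos (pi * X) > 1/3"
    | "y \<notin> \<int>" "y' \<notin> \<int>" "0 < sin (pi * y) \<longleftrightarrow> 0 < sin (pi * y')"
    using assms(2) by linarith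
  then show ?thesis
  proof cases
    case 1
    then show ?thesis using neg assms(1) by blast
  next
    case 2
    then show ?thesis using neg[of "X + 1" "y + 1" "y' + 1"] assms(1) by (simp add: height_diag cos_pi_add_1)
  next
    case 3
    then have s: "0 < saw y \<longleftrightarrow> 0 < saw y'" by (simp add: sin_pi_pos_iff)
    have ne: "saw y \<noteq> 0" "saw y' \<noteq> 0"
      using 3 saw_decomp[of y] saw_decomp[of y'] by (metis Ints_mult Ints_numeral Ints_of_int add_0)+
    have "saw (y - 1) - saw y = saw (y' - 1) - saw y'"
      using s ne saw_minus_1_pos[of y] saw_minus_1_pos[of y'] saw_minus_1_neg[of y] saw_minus_1_neg[of y']
      by (cases "0 < saw y") auto
    moreover have "height X z = fibre_time X (saw z) + half_period X * (1 - lam X) * (saw (z - 1) - saw z)" for z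
      by (simp add: height_def fibre_time_def osc_saw algebra_simps)
    ultimately have "fibre_time X (saw y) = fibre_time X (saw y')" using assms(1) by simp
    then show ?thesis using saw fibre_time_inj[of "saw y" "saw y'" X] saw_bounds[of y] saw_bounds[of y'] by auto
  qed
qed

text \<open>The immersion into the \<open>(P,Q)\<close>-plane identifies nothing but deck orbits,
  except for points of different sheets in the crossing region. The radius yields the height, the
  angle yields \<open>X\<close> modulo 1, and \<open>height_inj\<close> does the rest on a single
  circle.\<close>

lemma base_inj:
  assumes sl: "(X, y) \<in> slit_plane" "(X', y') \<in> slit_plane"
    and eq: "cP X y = cP X' y'" "cQ X y = cQ X' y'"
    and cs: "cP X y < 9/4 \<or> 0 < cP X y \<and> (0 < side X y \<longleftrightarrow> 0 < side X' y')"
  shows "\<exists>n m :: int. X' = X + of_int n + of_int m * 2 \<and> y' = y + of_int n"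
proof -
  have r: "sqradius X y = sqradius X' y'" using cP_cQ_sqradius[of X y] cP_cQ_sqradius[of X' y'] eq by simp
  then have h: "height X y = height X' y'" by (simp add: sqradius_def)
  have "sqrt (sqradius X y) \<noteq> 0" using sqradius_bounds(1)[of X y] by simp
  then have "cos (pi - 2 * pi * X) = cos (pi - 2 * pi * X')" "sin (pi - 2 * pi * X) = sin (pi - 2 * pi * X')"
    using eq unfolding cP_def cQ_def r by auto
  then have "\<exists>k::int. pi - 2 * pi * X = pi - 2 * pi * X' + 2 * pi * of_int k"
    using sin_cos_eq_iff[of "pi - 2 * pi * X" "pi - 2 * pi * X'"] by metis
  then obtain k :: int where "pi - 2 * pi * X = pi - 2 * pi * X' + 2 * pi * of_int k" by blast
  then have "2 * pi * X' = 2 * pi * (X + of_int k)" by (simp add: algebra_simps)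
  then have k: "X' = X + of_int k" by simp
  \<comment> \<open>The deck translation \<open>(- k, - k)\<close> moves the second point to the
    circle of the first.\<close>
  define z where "z = y' - of_int k"
  have zX: "X' = X + of_int k + of_int 0 * 2" "y' = z + of_int k" by (simp_all add: k z_def)
  have sz: "height X z = height X' y'" "cP X z = cP X' y'" "side X z = side X' y'"
    unfolding zX by (rule shift_invariants[symmetric])+
  have slz: "(X, z) \<in> slit_plane" using shift_slit_plane[OF sl(2), of "- k" 0] by (simp add: k z_def)
  have "1/3 < \<bar>cos (pi * X)\<bar> \<or> (y \<notin> \<int> \<and> z \<notin> \<int> \<and> (0 < sin (pi * y) \<longleftrightarrow> 0 < sin (pi * z)))"
  proof (cases "cP X y < 9/4")
    case True
    then show ?thesis using cP_low_imp by blast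
  next
    case False
    then have P: "0 < cP X y" "0 < cP X z" and s: "0 < side X y \<longleftrightarrow> 0 < side X z" using cs sz eq by auto
    have ni: "y \<notin> \<int>" "z \<notin> \<int>" using cP_pos_imp_not_int P sl slz by auto
    have "sin (pi * y) \<noteq> 0" "sin (pi * z) \<noteq> 0" using side_nonzero[OF P(1) sl(1)] side_nonzero[OF P(2) slz]
      by (auto simp: side_def)
    then have "0 < sin (pi * y) \<longleftrightarrow> 0 < sin (pi * z)"
      using s cP_pos_imp(2)[OF P(1)] by (auto simp: side_def zero_less_mult_iff)
    with ni show ?thesis by blast
  qed
  from height_inj[OF _ this] h sz obtain j :: int where "z = y + 2 * of_int j" by auto
  \<comment> \<open>The total displacement is \<open>(k, k + 2 * j)\<close>, which has the form
    \<open>(n + 2 * m, n)\<close> for \<open>n = k + 2 * j\<close> and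
    \<open>m = - j\<close>.\<close>
  then have "X' = X + of_int (k + 2 * j) + of_int (- j) * 2 \<and> y' = y + of_int (k + 2 * j)"
    by (simp add: k z_def algebra_simps)
  then show ?thesis by blast
qed

section \<open>Symplectic maps of base and fibre\<close>

lemma smooth_on_osc: "smooth_on UNIV (\<lambda>q. osc (fst q) (snd q))"
  and smooth_on_half_period: "smooth_on UNIV (\<lambda>q::real \<times> real. half_period (fst q))"
  and smooth_on_lam: "smooth_on UNIV (\<lambda>q::real \<times> real. lam (fst q))"
  unfolding osc_def half_period_def lam_def
  by (intro smooth_intros smooth_on_divide smooth_on_compose_UNIV[OF _ smooth_on_rho0]
      smooth_on_compose_UNIV[OF _ smooth_on_sstep]; simp)+

text \<open>A point off the slits with even \<open>y\<close> has
  \<open>cos (pi * X) < - 4/5\<close>, hence \<open>lam = 1\<close> nearby, and this kills the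
  sawtooth that jumps at even \<open>y\<close>; odd \<open>y\<close> is symmetric. At other
  \<open>y\<close> both sawtooths are affine, with constants absorbed into \<open>\<alpha>\<close>
  and \<open>\<beta>\<close>.\<close>

lemma height_local:
  assumes "p \<in> slit_plane"
  obtains U \<alpha> \<beta> where "open U" "p \<in> U"
    "\<And>q. q \<in> U \<Longrightarrow> height (fst q) (snd q) =
      osc (fst q) (snd q) + half_period (fst q) * (snd q - \<alpha> - \<beta> * lam (fst q))"
proof -
  obtain X y where p: "p = (X, y)" by fastforce
  show ?thesis
  proof (cases "y \<in> \<int>")
    case False
    let ?k = "\<lfloor>y\<rfloor>"
    let ?U = "UNIV \<times> {of_int ?k <..< of_int ?k + 1 :: real} :: (real \<times> real) set"
    have "of_int ?k < y" using False by (metis Ints_of_int floor_correct order_less_le)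
    then have pU: "p \<in> ?U" using p by (auto simp: floor_correct)
    have "\<exists>n::int. \<forall>t\<in>{of_int j <..< of_int j + 1}. saw t = t - 2 * of_int n" for j
    proof -
      have "2 * ((j + 1) div 2) \<le> j + 1" "j \<le> 2 * ((j + 1) div 2)" by presburger+
      then have "real_of_int (2 * ((j + 1) div 2)) \<le> real_of_int (j + 1)"
        "real_of_int j \<le> real_of_int (2 * ((j + 1) div 2))" using of_int_le_iff by blast+
      then show ?thesis by (intro exI[of _ "(j + 1) div 2"] ballI saw_eqI) auto
    qed
    then obtain n m where n: "\<forall>t\<in>{of_int ?k <..< of_int ?k + 1}. saw t = t - 2 * of_int n"
      and m: "\<forall>t\<in>{of_int (?k - 1) <..< of_int (?k - 1) + 1}. saw t = t - 2 * of_int m" by blast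
    show ?thesis
    proof (rule that[of ?U "1 + 2 * of_int m" "2 * of_int n - 1 - 2 * of_int m"])
      fix q assume "q \<in> ?U"
      then have "saw (snd q) = snd q - 2 * of_int n" "saw (snd q - 1) = snd q - 1 - 2 * of_int m"
        using n m by auto
      then show "height (fst q) (snd q) = osc (fst q) (snd q) + half_period (fst q) *
          (snd q - (1 + 2 * of_int m) - (2 * of_int n - 1 - 2 * of_int m) * lam (fst q))"
        unfolding height_def by (simp only:) (simp add: algebra_simps)
    qed (use pU in \<open>auto intro: open_Times\<close>)
  next
    case True
    then obtain k where k: "y = of_int k" by (auto elim: Ints_cases)
    define n where "n = k div 2"
    show ?thesis
    proof (cases "even k")
      case True
      then have y: "y = 2 * of_int n" by (auto simp: k n_def)
      have "rho0 X \<noteq> 0" using assms rho_even[of X n] by (simp add: p slit_plane_def y)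
      then have w: "cos (pi * X) < -1/3" by (simp add: rho0_eq_0_iff)
      let ?U = "{q. cos (pi * fst q) < -1/3} \<inter> UNIV \<times> {2 * of_int n - 1 <..< 2 * of_int n + 1 :: real}"
      show ?thesis
      proof (rule that[of ?U 0 "2 * of_int n"])
        show "open ?U" by (intro open_Int open_Times open_Collect_less continuous_intros) auto
        fix q assume "q \<in> ?U"
        then have "saw (snd q) = snd q - 2 * of_int n" "lam (fst q) = 1"
          by (auto intro!: saw_eqI lam_eq_1)
        then show "height (fst q) (snd q) = osc (fst q) (snd q) + half_period (fst q) *
          (snd q - 0 - (2 * of_int n) * lam (fst q))" by (simp add: height_def)
      qed (use w y p in auto)
    next
      case False
      then have "k = 2 * n + 1" by (simp add: n_def)
      then have y: "y = 2 * of_int n + 1" by (simp add: k)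
      have "rho0 (X + 1) \<noteq> 0" using assms rho_odd[of X n] by (simp add: p slit_plane_def y)
      then have w: "cos (pi * X) > 1/3" by (simp add: rho0_eq_0_iff cos_pi_add_1)
      let ?U = "{q. 1/3 < cos (pi * fst q)} \<inter> UNIV \<times> {2 * of_int n <..< 2 * of_int n + 2 :: real}"
      show ?thesis
      proof (rule that[of ?U "1 + 2 * of_int n" 0])
        show "open ?U" by (intro open_Int open_Times open_Collect_less continuous_intros) auto
        fix q assume q: "q \<in> ?U"
        then have "saw (snd q - 1) = snd q - 1 - 2 * of_int n" "lam (fst q) = 0"
          by (auto intro!: saw_eqI lam_eq_0)
        then show "height (fst q) (snd q) = osc (fst q) (snd q) + half_period (fst q) *
          (snd q - (1 + 2 * of_int n) - 0 * lam (fst q))" by (simp add: height_def)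
      qed (use w y p in auto)
    qed
  qed
qed

lemma smooth_on_height: "smooth_on slit_plane (\<lambda>q. height (fst q) (snd q))"
proof (rule smooth_on_local[OF open_slit_plane])
  fix p assume "p \<in> slit_plane"
  from height_local[OF this] obtain U \<alpha> \<beta> where U: "open U" "p \<in> U"
    "\<And>q. q \<in> U \<Longrightarrow> height (fst q) (snd q) =
      osc (fst q) (snd q) + half_period (fst q) * (snd q - \<alpha> - \<beta> * lam (fst q))"
    by blast
  have "smooth_on U (\<lambda>q. osc (fst q) (snd q) + half_period (fst q) * (snd q - \<alpha> - \<beta> * lam (fst q)))"
    by (intro smooth_intros U(1) smooth_on_subset[OF U(1) open_UNIV smooth_on_osc]
        smooth_on_subset[OF U(1) open_UNIV smooth_on_half_period]
        smooth_on_subset[OF U(1) open_UNIV smooth_on_lam]) auto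
  then have "smooth_on U (\<lambda>q. height (fst q) (snd q))"
    by (rule smooth_on_cong[OF U(1), rotated]) (simp add: U(3))
  with U show "\<exists>U. open U \<and> p \<in> U \<and> smooth_on U (\<lambda>q. height (fst q) (snd q))" by blast
qed

lemma smooth_on_real_has_derivative:
  fixes f :: "real \<Rightarrow> real"
  assumes "smooth_on UNIV f"
  shows "(f has_real_derivative deriv f x) (at x)"
  using smooth_on_deriv(1)[OF open_UNIV assms] by blast

text \<open>The \<open>X\<close>-derivative depends on the local branch but drops out of
  \<open>dX \<and> d(height)\<close>; it is therefore left as an unspecified
  \<open>A\<close>.\<close>

lemma height_has_derivative:
  assumes "p \<in> slit_plane"
  obtains A where "((\<lambda>q. height (fst q) (snd q)) has_derivative
    (\<lambda>v. A * fst v + rho (fst p) (snd p) * snd v)) (at p)"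
proof -
  obtain U \<alpha> \<beta> where U: "open U" "p \<in> U"
    "\<And>q. q \<in> U \<Longrightarrow> height (fst q) (snd q) =
      osc (fst q) (snd q) + half_period (fst q) * (snd q - \<alpha> - \<beta> * lam (fst q))"
    using height_local[OF assms] by blast
  have lam_smooth: "smooth_on UNIV lam"
    unfolding lam_def[abs_def]
    by (intro smooth_intros smooth_on_compose_UNIV[OF _ smooth_on_sstep]; simp)
  note [derivative_intros] = DERIV_compose_FDERIV[OF smooth_on_real_has_derivative[OF smooth_on_rho0]]
    DERIV_compose_FDERIV[OF smooth_on_real_has_derivative[OF lam_smooth]]
  let ?X = "fst p" and ?y = "snd p"
  let ?d = "deriv rho0 ?X" and ?d1 = "deriv rho0 (?X + 1)"
  let ?A = "(?d - ?d1) * sin (pi * ?y) / (2 * pi) + (?d + ?d1) * sin (2 * pi * ?y) / (16 * pi)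
    + 3/8 * (?d + ?d1) * (?y - \<alpha> - \<beta> * lam ?X) - half_period ?X * \<beta> * deriv lam ?X"
  have "((\<lambda>q. osc (fst q) (snd q) + half_period (fst q) * (snd q - \<alpha> - \<beta> * lam (fst q)))
    has_derivative (\<lambda>v. ?A * fst v + rho ?X ?y * snd v)) (at p)"
    unfolding osc_def half_period_def rho_eq_double_angle
    apply (rule derivative_eq_intros refl | simp)+
    apply (rule ext)
    apply (simp add: field_simps)
    done
  then have "((\<lambda>q. height (fst q) (snd q)) has_derivative (\<lambda>v. ?A * fst v + rho ?X ?y * snd v)) (at p)"
    by (rule has_derivative_transform_within_open[OF _ U(1,2)]) (simp add: U(3))
  then show ?thesis by (rule that)
qed

lemma smooth_on_cP: "smooth_on slit_plane (\<lambda>q. cP (fst q) (snd q))"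
  and smooth_on_cQ: "smooth_on slit_plane (\<lambda>q. cQ (fst q) (snd q))"
proof -
  have "smooth_on slit_plane (\<lambda>q. sqrt (sqradius (fst q) (snd q)))"
  proof (rule smooth_on_sqrt[OF open_slit_plane])
    show "smooth_on slit_plane (\<lambda>q. sqradius (fst q) (snd q))"
      unfolding sqradius_def
      by (intro smooth_intros smooth_on_divide smooth_on_height open_slit_plane) auto
    show "0 < sqradius (fst x) (snd x)" for x using sqradius_bounds(1)[of "fst x" "snd x"] by linarith
  qed
  then show "smooth_on slit_plane (\<lambda>q. cP (fst q) (snd q))" "smooth_on slit_plane (\<lambda>q. cQ (fst q) (snd q))"
    unfolding cP_def cQ_def by (intro smooth_intros open_slit_plane; simp)+
qed

section \<open>Translating the fibre and wrapping base and fibre into discs\<close>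

definition sg :: "real \<Rightarrow> real" where "sg = sstep 1 2"

lemma sg_props: "smooth_on UNIV sg" "smooth_on UNIV (deriv sg)" "0 \<le> sg t" "sg t \<le> 1" "0 \<le> deriv sg t"
  "t \<le> 1 \<Longrightarrow> sg t = 0" "2 \<le> t \<Longrightarrow> sg t = 1" "t < 1 \<or> 2 < t \<Longrightarrow> deriv sg t = 0"
proof -
  have lt: "(1::real) < 2" by simp
  show *: "smooth_on UNIV sg" unfolding sg_def by (rule smooth_on_sstep[OF lt])
  show "smooth_on UNIV (deriv sg)" by (rule smooth_on_deriv(2)[OF open_UNIV *])
  show "0 \<le> sg t" "sg t \<le> 1" unfolding sg_def by (rule sstep_bounds[OF lt])+
  show "0 \<le> deriv sg t" unfolding sg_def by (rule deriv_sstep_nonneg[OF lt])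
  show "t \<le> 1 \<Longrightarrow> sg t = 0" unfolding sg_def by (rule sstep_eq_0)
  show "2 \<le> t \<Longrightarrow> sg t = 1" unfolding sg_def by (rule sstep_eq_1[OF lt])
  show "t < 1 \<or> 2 < t \<Longrightarrow> deriv sg t = 0" unfolding sg_def by (rule deriv_sstep_eq_0[OF lt])
qed

definition pol :: "real \<Rightarrow> real \<Rightarrow> real \<times> real" where
  "pol c t = (sqrt c * cos t, sqrt c * sin t)"

text \<open>The sheet with \<open>a = 1\<close> has its fibre translated by \<open>sg P\<close>; symplecticity forces the base coordinate to
  move by \<open>deriv sg P * x\<close>. The constant offsets send the lower half (\<open>b = 0\<close>) downwards and the upper half
  (\<open>b = 1\<close>) upwards, so that the bulged sheets keep their vertical order.\<close>

definition bulge :: "real \<Rightarrow> real \<Rightarrow> real \<Rightarrow> real \<Rightarrow> real \<Rightarrow> real \<Rightarrow> real" where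
  "bulge e a b P Q x = e * Q + deriv sg P * (a * (x - pi / 2) + b * pi)"

text \<open>The base area still available at \<open>P\<close> is about \<open>2 * pi * (1 - sg P)\<close>, whereas the fibre needs area at most
  \<open>pi * (1 + sg P)\<close>: the two never exceed \<open>3 * pi\<close> by more than a multiple of \<open>e\<close>.\<close>

definition target :: "real \<Rightarrow> real \<Rightarrow> real \<Rightarrow> real \<Rightarrow> real \<Rightarrow> real \<Rightarrow> real \<Rightarrow> (real \<times> real) \<times> (real \<times> real)" where
  "target e a b P Q x y =
    (pol (2 * (1 + rmax\<^sup>2 * e - sg P - rmax * e * P)) (- bulge e a b P Q x / (deriv sg P + rmax * e)),
     pol (y + a * sg P + 1/2) (- 2 * x))"

lemma pol_has_derivative:
  assumes c: "(c has_derivative c') (at w)" and t: "(t has_derivative t') (at w)" and pos: "0 < c w"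
  obtains D1 D2 where "((\<lambda>w. sqrt (c w) * cos (t w)) has_derivative D1) (at w)"
    "((\<lambda>w. sqrt (c w) * sin (t w)) has_derivative D2) (at w)"
    "\<And>v u. D1 v * D2 u - D2 v * D1 u = (c' v * t' u - t' v * c' u) / 2"
proof -
  let ?s = "sqrt (c w)"
  let ?D1 = "\<lambda>v. c' v / (2 * ?s) * cos (t w) - ?s * sin (t w) * t' v"
  let ?D2 = "\<lambda>v. c' v / (2 * ?s) * sin (t w) + ?s * cos (t w) * t' v"
  have s: "((\<lambda>w. sqrt (c w)) has_derivative (\<lambda>v. c' v / (2 * ?s))) (at w)"
    by (rule has_derivative_eq_rhs[OF DERIV_compose_FDERIV[OF DERIV_real_sqrt[OF pos] c]])
      (simp add: fun_eq_iff divide_simps)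
  have co: "((\<lambda>w. cos (t w)) has_derivative (\<lambda>v. - sin (t w) * t' v)) (at w)"
    and si: "((\<lambda>w. sin (t w)) has_derivative (\<lambda>v. cos (t w) * t' v)) (at w)"
    by (rule has_derivative_eq_rhs[OF DERIV_compose_FDERIV[OF DERIV_cos t]]
        has_derivative_eq_rhs[OF DERIV_compose_FDERIV[OF DERIV_sin t]]; simp add: fun_eq_iff)+
  have 1: "((\<lambda>w. sqrt (c w) * cos (t w)) has_derivative ?D1) (at w)"
    by (rule has_derivative_eq_rhs[OF has_derivative_mult[OF s co]]) (simp add: fun_eq_iff)
  have 2: "((\<lambda>w. sqrt (c w) * sin (t w)) has_derivative ?D2) (at w)"
    by (rule has_derivative_eq_rhs[OF has_derivative_mult[OF s si]]) (simp add: fun_eq_iff)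
  have "?D1 v * ?D2 u - ?D2 v * ?D1 u = (c' v * t' u - t' v * c' u) / 2" for v u
  proof -
    have alg: "(p / (2 * s) * C - s * S * q) * (r / (2 * s) * S + s * C * k)
        - (p / (2 * s) * S + s * C * q) * (r / (2 * s) * C - s * S * k) = (C\<^sup>2 + S\<^sup>2) * ((p * k - q * r) / 2)"
      if "s \<noteq> 0" for p q r k s C S :: real
      using that by (simp add: field_simps power2_eq_square)
    show ?thesis using alg[of ?s "c' v" "cos (t w)" "sin (t w)" "t' v" "c' u" "t' u"] pos by simp
  qed
  from that[OF 1 2 this] show ?thesis .
qed

text \<open>Two cancellations. The fibre translation adds \<open>a * deriv sg P\<close> times
  \<open>dx \<and> dP\<close>, and the shift of the base coordinate by
  \<open>a * deriv sg P * x\<close> removes it. In the wrapping of the base the squared radius has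
  derivative \<open>- 2 * F\<close> in \<open>P\<close> while the angle is divided by
  \<open>F\<close>, so area is preserved although \<open>F\<close> varies.\<close>

lemma target_has_derivative:
  assumes P: "(P has_derivative P') (at w)" and Q: "(Q has_derivative Q') (at w)"
    and x: "(x has_derivative x') (at w)" and y: "(y has_derivative y') (at w)"
    and e: "0 < e" and c1: "0 < 2 * (1 + rmax\<^sup>2 * e - sg (P w) - rmax * e * P w)"
    and c2: "0 < y w + a * sg (P w) + 1/2"
  obtains D where "((\<lambda>w. target e a b (P w) (Q w) (x w) (y w)) has_derivative D) (at w)"
    "\<And>v u. omega (D v) (D u) = e * (P' v * Q' u - Q' v * P' u) + (x' v * y' u - y' v * x' u)"
proof -
  define p where "p = P w"
  define s1 where "s1 = deriv sg p"
  define F where "F = s1 + rmax * e"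
  have "rmax * e > 0" using e hbound_ge by (simp add: rmax_def)
  then have F: "F > 0" using sg_props(5)[of p] by (simp add: F_def s1_def)
  define m where "m = a * (x w - pi / 2) + b * pi"
  define s2 where "s2 = deriv (deriv sg) p"
  \<comment> \<open>Collects all terms of the derivative of the angle that are multiples of
    \<open>P'\<close>; they vanish against the derivative of the radius, which is itself a multiple
    of \<open>P'\<close>.\<close>
  define k where "k = - (s2 * m) / F + bulge e a b p (Q w) (x w) * s2 / F\<^sup>2"
  have sgP: "((\<lambda>w. sg (P w)) has_derivative (\<lambda>v. P' v * s1)) (at w)"
    using DERIV_compose_FDERIV[OF smooth_on_real_has_derivative[OF sg_props(1)] P] by (simp add: s1_def p_def)
  have sgP': "((\<lambda>w. deriv sg (P w)) has_derivative (\<lambda>v. P' v * s2)) (at w)"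
    using DERIV_compose_FDERIV[OF smooth_on_real_has_derivative[OF sg_props(2)] P] by (simp add: s2_def p_def)
  have "((\<lambda>w. 2 * (1 + rmax\<^sup>2 * e - sg (P w) - rmax * e * P w)) has_derivative
      (\<lambda>v. 2 * (0 - P' v * s1 - rmax * e * P' v))) (at w)"
    by (intro has_derivative_mult_right has_derivative_diff sgP P has_derivative_const)
  moreover have "(\<lambda>v. 2 * (0 - P' v * s1 - rmax * e * P' v)) = (\<lambda>v. - 2 * F * P' v)"
    by (rule ext) (simp add: F_def algebra_simps)
  ultimately have d1: "((\<lambda>w. 2 * (1 + rmax\<^sup>2 * e - sg (P w) - rmax * e * P w)) has_derivative
      (\<lambda>v. - 2 * F * P' v)) (at w)" by simp
  have "((\<lambda>w. bulge e a b (P w) (Q w) (x w)) has_derivative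
     (\<lambda>v. e * Q' v + (s1 * (a * (x' v - 0) + 0) + P' v * s2 * m))) (at w)"
    unfolding bulge_def m_def s1_def p_def
    by (intro has_derivative_add has_derivative_mult has_derivative_mult_right has_derivative_diff sgP' Q x
        has_derivative_const)
  then have db: "((\<lambda>w. bulge e a b (P w) (Q w) (x w)) has_derivative
     (\<lambda>v. e * Q' v + s1 * a * x' v + P' v * s2 * m)) (at w)"
    by (rule has_derivative_eq_rhs) (simp add: fun_eq_iff)
  have dF: "((\<lambda>w. deriv sg (P w) + rmax * e) has_derivative (\<lambda>v. P' v * s2)) (at w)"
    using has_derivative_add[OF sgP' has_derivative_const[of "rmax * e"]] by simp
  have Fw: "deriv sg (P w) + rmax * e = F" by (simp add: F_def s1_def p_def)
  have "((\<lambda>w. - bulge e a b (P w) (Q w) (x w) / (deriv sg (P w) + rmax * e)) has_derivative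
     (\<lambda>v. - (e * Q' v + s1 * a * x' v) / F + k * P' v)) (at w)"
  proof (rule has_derivative_eq_rhs[OF has_derivative_divide'[OF has_derivative_minus[OF db] dF]])
    show "deriv sg (P w) + rmax * e \<noteq> 0" using F Fw by simp
    show "(\<lambda>v. (- (e * Q' v + s1 * a * x' v + P' v * s2 * m) * (deriv sg (P w) + rmax * e)
        - - bulge e a b (P w) (Q w) (x w) * (P' v * s2)) / ((deriv sg (P w) + rmax * e) * (deriv sg (P w) + rmax * e)))
      = (\<lambda>v. - (e * Q' v + s1 * a * x' v) / F + k * P' v)"
      unfolding Fw unfolding k_def p_def using F by (auto simp: fun_eq_iff field_simps power2_eq_square)
  qed
  note d2 = this
  have d3: "((\<lambda>w. y w + a * sg (P w) + 1/2) has_derivative (\<lambda>v. y' v + a * (P' v * s1) + 0)) (at w)"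
    by (intro has_derivative_add y has_derivative_mult_right sgP has_derivative_const)
  have d4: "((\<lambda>w. - 2 * x w) has_derivative (\<lambda>v. - 2 * x' v)) (at w)"
    by (intro has_derivative_mult_right x)
  from pol_has_derivative[OF d1 d2 c1] obtain A1 A2 where A:
    "((\<lambda>w. sqrt (2 * (1 + rmax\<^sup>2 * e - sg (P w) - rmax * e * P w)) *
        cos (- bulge e a b (P w) (Q w) (x w) / (deriv sg (P w) + rmax * e))) has_derivative A1) (at w)"
    "((\<lambda>w. sqrt (2 * (1 + rmax\<^sup>2 * e - sg (P w) - rmax * e * P w)) *
        sin (- bulge e a b (P w) (Q w) (x w) / (deriv sg (P w) + rmax * e))) has_derivative A2) (at w)"
    "\<And>v u. A1 v * A2 u - A2 v * A1 u = (- 2 * F * P' v * (- (e * Q' u + s1 * a * x' u) / F + k * P' u)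
        - (- (e * Q' v + s1 * a * x' v) / F + k * P' v) * (- 2 * F * P' u)) / 2"
    by blast
  from pol_has_derivative[OF d3 d4 c2] obtain B1 B2 where B:
    "((\<lambda>w. sqrt (y w + a * sg (P w) + 1/2) * cos (- 2 * x w)) has_derivative B1) (at w)"
    "((\<lambda>w. sqrt (y w + a * sg (P w) + 1/2) * sin (- 2 * x w)) has_derivative B2) (at w)"
    "\<And>v u. B1 v * B2 u - B2 v * B1 u = ((y' v + a * (P' v * s1) + 0) * (- 2 * x' u)
      - (- 2 * x' v) * (y' u + a * (P' u * s1) + 0)) / 2" by blast
  have "omega ((A1 v, A2 v), B1 v, B2 v) ((A1 u, A2 u), B1 u, B2 u)
      = e * (P' v * Q' u - Q' v * P' u) + (x' v * y' u - y' v * x' u)" for v u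
  proof -
    have "A1 v * A2 u - A2 v * A1 u = P' v * (e * Q' u + s1 * a * x' u) - (e * Q' v + s1 * a * x' v) * P' u"
      unfolding A(3) using F by (simp add: field_simps)
    moreover have "B1 v * B2 u - B2 v * B1 u = - (y' v + a * (P' v * s1)) * x' u + x' v * (y' u + a * (P' u * s1))"
      unfolding B(3) by (simp add: field_simps)
    moreover have "omega ((A1 v, A2 v), B1 v, B2 v) ((A1 u, A2 u), B1 u, B2 u) =
        (A1 v * A2 u - A2 v * A1 u) + (B1 v * B2 u - B2 v * B1 u)" by (simp add: omega_def)
    ultimately show ?thesis by (simp add: algebra_simps)
  qed
  moreover have "((\<lambda>w. target e a b (P w) (Q w) (x w) (y w)) has_derivative
      (\<lambda>v. ((A1 v, A2 v), B1 v, B2 v))) (at w)"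
    unfolding target_def pol_def by (intro has_derivative_Pair A B)
  ultimately show ?thesis using that[of "\<lambda>v. ((A1 v, A2 v), B1 v, B2 v)"] by blast
qed

lemma smooth_on_target:
  assumes S: "open S" and "smooth_on S e" "smooth_on S P" "smooth_on S Q" "smooth_on S x" "smooth_on S y"
    and pos: "\<And>w. w \<in> S \<Longrightarrow> 0 < e w"
      "\<And>w. w \<in> S \<Longrightarrow> 0 < 2 * (1 + rmax\<^sup>2 * e w - sg (P w) - rmax * e w * P w)"
      "\<And>w. w \<in> S \<Longrightarrow> 0 < y w + a * sg (P w) + 1/2"
  shows "smooth_on S (\<lambda>w. target (e w) a b (P w) (Q w) (x w) (y w))"
proof -
  have "rmax > 0" using hbound_ge by (simp add: rmax_def)
  then have "deriv sg (P w) + rmax * e w \<noteq> 0" if "w \<in> S" for w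
    using sg_props(5)[of "P w"] pos(1)[OF that] by (simp add: add_nonneg_pos less_imp_neq[symmetric])
  then show ?thesis
    unfolding target_def pol_def bulge_def
    by (intro smooth_intros smooth_on_sqrt smooth_on_divide assms smooth_on_compose_UNIV[OF S sg_props(1)]
        smooth_on_compose_UNIV[OF S sg_props(2)]) auto
qed

text \<open>The area-preserving map of the open unit disc onto the rectangle with sides \<open>pi\<close> and 1.\<close>

definition disc_x :: "real \<times> real \<Rightarrow> real" where
  "disc_x z = fst z * sqrt (1 - (fst z)\<^sup>2) + arcsin (fst z)"

definition disc_y :: "real \<times> real \<Rightarrow> real" where
  "disc_y z = snd z / (2 * sqrt (1 - (fst z)\<^sup>2))"

lemma ball_fst: "z \<in> ball 0 1 \<Longrightarrow> (fst z)\<^sup>2 + (snd z)\<^sup>2 < (1::real)"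
  "z \<in> ball 0 1 \<Longrightarrow> \<bar>fst z\<bar> < (1::real)" "z \<in> ball 0 1 \<Longrightarrow> 0 < 1 - (fst z)\<^sup>2" for z :: "real \<times> real"
proof -
  assume "z \<in> ball 0 1"
  then have "sqrt ((fst z)\<^sup>2 + (snd z)\<^sup>2) < 1" by (simp add: norm_prod_def)
  then show *: "(fst z)\<^sup>2 + (snd z)\<^sup>2 < 1" by simp
  have "0 \<le> (snd z)\<^sup>2" by simp
  with * have "(fst z)\<^sup>2 < 1" by linarith
  then show "\<bar>fst z\<bar> < 1" "0 < 1 - (fst z)\<^sup>2" by (simp_all add: abs_square_less_1)
qed

lemma smooth_on_disc: "smooth_on (ball 0 1) disc_x" "smooth_on (ball 0 1) disc_y"
proof -
  have s: "smooth_on (ball 0 1) (\<lambda>z::real \<times> real. sqrt (1 - (fst z)\<^sup>2))"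
    by (intro smooth_on_sqrt smooth_intros) (use ball_fst in auto)
  have "smooth_on (ball 0 1) (\<lambda>z::real \<times> real. arcsin (fst z))"
    by (rule smooth_on_compose[OF _ _ _ smooth_on_arcsin]) (use ball_fst(2) in \<open>auto intro!: smooth_intros simp: abs_less_iff\<close>)
  with s show "smooth_on (ball 0 1) disc_x"
    unfolding disc_x_def[abs_def] by (intro smooth_intros) auto
  show "smooth_on (ball 0 1) disc_y"
    unfolding disc_y_def[abs_def] by (intro smooth_intros smooth_on_divide s) (use ball_fst(3) in force)+
qed

text \<open>The derivative is the length of the vertical chord at \<open>p\<close>, so
  \<open>disc_x\<close> measures the signed area of the disc between the chords at 0 and
  \<open>p\<close>.\<close>

lemma disc_x_deriv: "\<bar>p\<bar> < 1 \<Longrightarrow> ((\<lambda>p. p * sqrt (1 - p\<^sup>2) + arcsin p) has_real_derivative 2 * sqrt (1 - p\<^sup>2)) (at p)"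
proof -
  assume p: "\<bar>p\<bar> < 1"
  then have pos: "0 < 1 - p\<^sup>2" by (simp add: abs_square_less_1)
  define s where "s = sqrt (1 - p\<^sup>2)"
  have s: "s > 0" "s * s = 1 - p\<^sup>2" using pos by (auto simp: s_def)
  have "((\<lambda>p. p * sqrt (1 - p\<^sup>2) + arcsin p) has_real_derivative s + p * ((- 2 * p) * (inverse s / 2)) + inverse s) (at p)"
    using p pos unfolding s_def
    by (auto intro!: derivative_eq_intros simp: abs_less_iff field_simps)
  moreover have "s + p * ((- 2 * p) * (inverse s / 2)) + inverse s = 2 * s"
    using s by (simp add: field_simps power2_eq_square)
  ultimately show ?thesis unfolding s_def by (rule DERIV_cong)
qed

lemma disc_has_derivative:
  assumes "z \<in> ball 0 1"
  obtains x' y' where "(disc_x has_derivative x') (at z)" "(disc_y has_derivative y') (at z)"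
    "\<And>v u. x' v * y' u - y' v * x' u = fst v * snd u - snd v * fst u"
proof -
  define s where "s = sqrt (1 - (fst z)\<^sup>2)"
  have s: "s > 0" using ball_fst(3)[OF assms] by (simp add: s_def)
  have 1: "(disc_x has_derivative (\<lambda>v. fst v * (2 * s))) (at z)"
    unfolding disc_x_def[abs_def] s_def
    using DERIV_compose_FDERIV[OF disc_x_deriv[OF ball_fst(2)[OF assms]] has_derivative_fst[OF has_derivative_ident]] .
  have "((\<lambda>p. sqrt (1 - p\<^sup>2)) has_real_derivative (- fst z / s)) (at (fst z))"
    using ball_fst(3)[OF assms] s unfolding s_def by (auto intro!: derivative_eq_intros simp: field_simps)
  from DERIV_compose_FDERIV[OF this has_derivative_fst[OF has_derivative_ident]]
  have "((\<lambda>z. sqrt (1 - (fst z)\<^sup>2)) has_derivative (\<lambda>v. fst v * (- fst z / s))) (at z)" .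
  from has_derivative_mult_right[OF this, of 2]
  have "((\<lambda>z. 2 * sqrt (1 - (fst z)\<^sup>2)) has_derivative (\<lambda>v. 2 * (fst v * (- fst z / s)))) (at z)" .
  from has_derivative_divide'[OF has_derivative_snd[OF has_derivative_ident] this]
  have 2: "(disc_y has_derivative (\<lambda>v. (snd v * (2 * s) - snd z * (2 * (fst v * (- fst z / s)))) / ((2 * s) * (2 * s)))) (at z)"
    unfolding disc_y_def[abs_def] using s by (simp add: s_def)
  show ?thesis by (rule that[OF 1 2]) (use s in \<open>simp add: field_simps\<close>)
qed

lemma disc_bounds: "z \<in> ball 0 1 \<Longrightarrow> \<bar>disc_x z\<bar> < pi / 2" "z \<in> ball 0 1 \<Longrightarrow> \<bar>disc_y z\<bar> < 1/2"
  and disc_inj: "z \<in> ball 0 1 \<Longrightarrow> z' \<in> ball 0 1 \<Longrightarrow> disc_x z = disc_x z' \<Longrightarrow> disc_y z = disc_y z' \<Longrightarrow> z = z'"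
proof -
  let ?F = "\<lambda>p. p * sqrt (1 - p\<^sup>2) + arcsin p"
  have mono: "?F p < ?F q" if "-1 \<le> p" "p < q" "q \<le> 1" for p q
  proof (rule DERIV_pos_imp_increasing_open[OF that(2)])
    show "\<exists>y. DERIV ?F t :> y \<and> 0 < y" if "p < t" "t < q" for t
      using disc_x_deriv[of t] that \<open>-1 \<le> p\<close> \<open>q \<le> 1\<close>
      by (intro exI[of _ "2 * sqrt (1 - t\<^sup>2)"]) (auto simp: abs_square_less_1 abs_less_iff)
    show "continuous_on {p..q} ?F" using that by (intro continuous_intros) auto
  qed
  show "\<bar>disc_x z\<bar> < pi / 2" if "z \<in> ball 0 1" for z
  proof -
    have "- (pi / 2) < disc_x z" "disc_x z < pi / 2"
      using mono[of "-1" "fst z"] mono[of "fst z" 1] ball_fst(2)[OF that] by (simp_all add: disc_x_def abs_less_iff)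
    then show ?thesis by linarith
  qed
  show "\<bar>disc_y z\<bar> < 1/2" if "z \<in> ball 0 1" for z
  proof -
    have "\<bar>snd z\<bar> < sqrt (1 - (fst z)\<^sup>2)"
      using ball_fst(1)[OF that] by (intro real_less_rsqrt) simp
    then show ?thesis using ball_fst(3)[OF that] by (simp add: disc_y_def abs_divide divide_less_eq)
  qed
  show "z = z'" if "z \<in> ball 0 1" "z' \<in> ball 0 1" "disc_x z = disc_x z'" "disc_y z = disc_y z'"
  proof -
    have "fst z = fst z'"
      using mono[of "fst z" "fst z'"] mono[of "fst z'" "fst z"] ball_fst(2)[OF that(1)] ball_fst(2)[OF that(2)] that(3)
      by (cases "fst z" "fst z'" rule: linorder_cases) (auto simp: disc_x_def abs_less_iff)
    moreover from this have "snd z = snd z'" using that(4) ball_fst(3)[OF that(1)] by (simp add: disc_y_def)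
    ultimately show ?thesis by (simp add: prod_eq_iff)
  qed
qed

section \<open>The embedding\<close>

lemma rmax_pos: "0 < rmax"
  using hbound_ge by (simp add: rmax_def)

text \<open>The summand \<open>rmax\<^sup>2 * e\<close> is there to outweigh
  \<open>rmax * e * P\<close>, as \<open>\<bar>P\<bar>\<close> stays below
  \<open>rmax\<close>.\<close>

lemma target_sqradius_pos:
  assumes "0 < e"
  shows "0 < 2 * (1 + rmax\<^sup>2 * e - sg (cP X y) - rmax * e * cP X y)"
proof -
  have "0 < rmax * e * (rmax - cP X y)"
    using assms rmax_pos cP_bound[of X y] by (intro mult_pos_pos) auto
  then show ?thesis using sg_props(4)[of "cP X y"] by (simp add: algebra_simps power2_eq_square)
qed

section \<open>The family on the unit torus\<close>

definition unit_emb ::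
  "real \<times> ((real \<times> real) \<times> (real \<times> real)) \<Rightarrow> (real \<times> real) \<times> (real \<times> real)" where
  "unit_emb w = (let X = fst (uncollapse (fst (snd w))); y = snd (uncollapse (fst (snd w))); z = snd (snd w) in
     target (fst w) (of_bool (0 < side X y)) (of_bool (0 < cQ X y)) (cP X y) (cQ X y) (disc_x z) (disc_y z))"

text \<open>The switches can jump only where they have no effect. For \<open>P < 1\<close> both
  \<open>sg\<close> and its derivative vanish. Between 1 and 9/4 neither \<open>side\<close> nor
  \<open>Q\<close> has zeros. Beyond 2, where \<open>Q\<close> may change sign, the derivative of
  \<open>sg\<close> vanishes and with it the influence of \<open>b\<close>.\<close>

lemma target_local:
  assumes "p \<in> slit_plane"
  obtains U a b where "open U" "p \<in> U" "U \<subseteq> slit_plane" "0 \<le> a"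
    "\<And>q e x y. q \<in> U \<Longrightarrow>
      target e (of_bool (0 < side (fst q) (snd q))) (of_bool (0 < cQ (fst q) (snd q)))
        (cP (fst q) (snd q)) (cQ (fst q) (snd q)) x y
      = target e a b (cP (fst q) (snd q)) (cQ (fst q) (snd q)) x y"
proof -
  let ?P = "\<lambda>q. cP (fst q) (snd q)" and ?Q = "\<lambda>q. cQ (fst q) (snd q)" and ?S = "\<lambda>q. side (fst q) (snd q)"
  have cont: "continuous_on slit_plane ?P" "continuous_on slit_plane ?Q" "continuous_on slit_plane ?S"
    using smooth_on_imp_continuous_on[OF smooth_on_cP] smooth_on_imp_continuous_on[OF smooth_on_cQ]
    by (auto simp: side_def intro!: continuous_intros)
  have op: "open (slit_plane \<inter> f -` T)" if "continuous_on slit_plane f" "open T" for f :: "real \<times> real \<Rightarrow> real" and T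
    using continuous_open_preimage[OF that(1) open_slit_plane that(2)] .
  have sgn: "of_bool (0 < s) = (of_bool (0 < r) :: real)" if "0 < s * r" for s r :: real
    using that by (auto simp: zero_less_mult_iff)
  have contS: "continuous_on slit_plane (\<lambda>q. ?S q * ?S p)" "continuous_on slit_plane (\<lambda>q. ?Q q * ?Q p)"
    using cont by (auto intro!: continuous_intros)
  consider "?P p < 1" | "1 \<le> ?P p" "?P p < 9/4" | "9/4 \<le> ?P p" by linarith
  then show ?thesis
  proof cases
    case 1
    let ?U = "slit_plane \<inter> ?P -` {..<1}"
    show ?thesis
      by (rule that[of ?U 0 0])
        (use 1 assms in \<open>auto intro: op cont simp: target_def bulge_def sg_props\<close>)
  next
    case 2
    let ?U = "(slit_plane \<inter> ?P -` {0<..}) \<inter> (slit_plane \<inter> (\<lambda>q. ?S q * ?S p) -` {0<..}) \<inter>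
      (slit_plane \<inter> (\<lambda>q. ?Q q * ?Q p) -` {0<..})"
    show ?thesis
    proof (rule that[of ?U "of_bool (0 < ?S p)" "of_bool (0 < ?Q p)"])
      show "open ?U" by (intro open_Int op cont contS) auto
      have "?S p \<noteq> 0" "?Q p \<noteq> 0"
        using side_nonzero[of "fst p" "snd p"] side_pos_iff(2)[of "fst p" "snd p"] 2 assms by auto
      then show "p \<in> ?U" using 2 assms by (auto simp: zero_less_mult_iff)
    next
      fix q e x y assume "q \<in> ?U"
      then have "of_bool (0 < ?S q) = (of_bool (0 < ?S p) :: real)" "of_bool (0 < ?Q q) = (of_bool (0 < ?Q p) :: real)"
        by (intro sgn; simp)+
      then show "target e (of_bool (0 < ?S q)) (of_bool (0 < ?Q q)) (?P q) (?Q q) x y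
        = target e (of_bool (0 < ?S p)) (of_bool (0 < ?Q p)) (?P q) (?Q q) x y" by (simp only:)
    qed auto
  next
    case 3
    let ?U = "(slit_plane \<inter> ?P -` {2<..}) \<inter> (slit_plane \<inter> (\<lambda>q. ?S q * ?S p) -` {0<..})"
    show ?thesis
    proof (rule that[of ?U "of_bool (0 < ?S p)" 0])
      show "open ?U" by (intro open_Int op cont contS) auto
      have "?S p \<noteq> 0" using side_nonzero[of "fst p" "snd p"] 3 assms by auto
      then show "p \<in> ?U" using 3 assms by (auto simp: zero_less_mult_iff)
    next
      fix q e x y assume q: "q \<in> ?U"
      then have "of_bool (0 < ?S q) = (of_bool (0 < ?S p) :: real)" by (intro sgn) simp
      moreover have "deriv sg (?P q) = 0" using q by (simp add: sg_props)
      ultimately show "target e (of_bool (0 < ?S q)) (of_bool (0 < ?Q q)) (?P q) (?Q q) x y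
        = target e (of_bool (0 < ?S p)) 0 (?P q) (?Q q) x y" by (simp only: target_def bulge_def) simp
    qed auto
  qed
qed

abbreviation unit_dom :: "((real \<times> real) \<times> (real \<times> real)) set" where
  "unit_dom \<equiv> (UNIV - lattice 1) \<times> ball 0 1"

lemma open_unit_dom: "open unit_dom"
  by (intro open_Times open_punctured open_ball)

lemma smooth_on_unit_emb: "smooth_on ({0<..} \<times> unit_dom) unit_emb"
proof (rule smooth_on_local)
  let ?W = "{0<..} \<times> unit_dom :: (real \<times> (real \<times> real) \<times> (real \<times> real)) set"
  show oW: "open ?W" by (intro open_Times open_unit_dom) auto
  fix w0 assume w0: "w0 \<in> ?W"
  let ?g = "\<lambda>w :: real \<times> (real \<times> real) \<times> (real \<times> real). uncollapse (fst (snd w))"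
  have mem: "?g w \<in> slit_plane" if "w \<in> ?W" for w using that by (auto intro: uncollapse_props)
  from target_local[OF mem[OF w0]] obtain U a b where U: "open U" "?g w0 \<in> U" "U \<subseteq> slit_plane" "0 \<le> a"
    "\<And>q e x y. q \<in> U \<Longrightarrow>
      target e (of_bool (0 < side (fst q) (snd q))) (of_bool (0 < cQ (fst q) (snd q)))
        (cP (fst q) (snd q)) (cQ (fst q) (snd q)) x y
      = target e a b (cP (fst q) (snd q)) (cQ (fst q) (snd q)) x y" by blast
  have "smooth_on ?W (\<lambda>w. fst (snd w))" by (intro smooth_intros oW)
  from smooth_on_compose[OF oW open_punctured _ smooth_on_uncollapse this]
  have sg: "smooth_on ?W ?g" by auto
  let ?V = "?W \<inter> ?g -` U"
  have oV: "open ?V"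
    by (rule continuous_open_preimage[OF smooth_on_imp_continuous_on[OF sg] oW U(1)])
  have sV: "smooth_on ?V f" if "smooth_on ?W f" for f :: "_ \<Rightarrow> real \<times> real"
    by (rule smooth_on_subset[OF oV oW that]) auto
  have P: "smooth_on ?V (\<lambda>w. cP (fst (?g w)) (snd (?g w)))"
    by (rule smooth_on_compose[OF oV open_slit_plane _ smooth_on_cP sV[OF sg]]) (use mem in auto)
  have Q: "smooth_on ?V (\<lambda>w. cQ (fst (?g w)) (snd (?g w)))"
    by (rule smooth_on_compose[OF oV open_slit_plane _ smooth_on_cQ sV[OF sg]]) (use mem in auto)
  have z: "smooth_on ?V (\<lambda>w. snd (snd w))" by (intro smooth_intros oV)
  have x: "smooth_on ?V (\<lambda>w. disc_x (snd (snd w)))"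
    by (rule smooth_on_compose[OF oV open_ball _ smooth_on_disc(1) z]) auto
  have y: "smooth_on ?V (\<lambda>w. disc_y (snd (snd w)))"
    by (rule smooth_on_compose[OF oV open_ball _ smooth_on_disc(2) z]) auto
  have "smooth_on ?V (\<lambda>w. target (fst w) a b (cP (fst (?g w)) (snd (?g w))) (cQ (fst (?g w)) (snd (?g w)))
      (disc_x (snd (snd w))) (disc_y (snd (snd w))))"
  proof (rule smooth_on_target[OF oV _ P Q x y])
    show "smooth_on ?V fst" by (intro smooth_on_bounded_linear oV bounded_linear_fst)
    fix w assume w: "w \<in> ?V"
    then show "0 < fst w" by auto
    then show "0 < 2 * (1 + rmax\<^sup>2 * fst w - sg (cP (fst (?g w)) (snd (?g w))) - rmax * fst w * cP (fst (?g w)) (snd (?g w)))"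
      by (rule target_sqradius_pos)
    have "\<bar>disc_y (snd (snd w))\<bar> < 1/2" by (rule disc_bounds) (use w in auto)
    moreover have "0 \<le> a * sg (cP (fst (?g w)) (snd (?g w)))" using U(4) sg_props(3) by simp
    ultimately show "0 < disc_y (snd (snd w)) + a * sg (cP (fst (?g w)) (snd (?g w))) + 1/2" by linarith
  qed
  then have "smooth_on ?V unit_emb"
    by (rule smooth_on_cong[OF oV, rotated]) (simp add: unit_emb_def Let_def U(5))
  then show "\<exists>U. open U \<and> w0 \<in> U \<and> smooth_on U unit_emb" using oV w0 U(2) by blast
qed

text \<open>Composes the area-preserving steps: \<open>collapse\<close> inverted, conjugate
  coordinates, polar coordinates and \<open>target\<close>. The factor \<open>e\<close> on the base
  is what the dilation by \<open>sqrt e\<close> will absorb.\<close>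

lemma unit_emb_symplectic:
  assumes e: "0 < e" and w0: "w0 \<in> unit_dom"
  obtains D where "((\<lambda>w. unit_emb (e, w)) has_derivative D) (at w0)"
    "\<And>v u. omega (D v) (D u) = e * (fst (fst v) * snd (fst u) - snd (fst v) * fst (fst u))
      + (fst (snd v) * snd (snd u) - snd (snd v) * fst (snd u))"
proof -
  let ?g = "\<lambda>w :: (real \<times> real) \<times> (real \<times> real). uncollapse (fst w)"
  define p where "p = ?g w0"
  have nl: "fst w0 \<notin> lattice 1" and zb: "snd w0 \<in> ball 0 1" using w0 by auto
  have p: "p \<in> slit_plane" unfolding p_def by (rule uncollapse_props[OF nl])
  from target_local[OF p] obtain U a b where U: "open U" "p \<in> U" "U \<subseteq> slit_plane" "0 \<le> a"
    "\<And>q e x y. q \<in> U \<Longrightarrow>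
      target e (of_bool (0 < side (fst q) (snd q))) (of_bool (0 < cQ (fst q) (snd q)))
        (cP (fst q) (snd q)) (cQ (fst q) (snd q)) x y
      = target e a b (cP (fst q) (snd q)) (cQ (fst q) (snd q)) x y" by blast
  define r where "r = rho (fst p) (snd p)"
  define k where "k = xi_y (fst p) (snd p)"
  have r: "r > 0" using p by (simp add: slit_plane_def r_def)
  define dX :: "(real \<times> real) \<times> (real \<times> real) \<Rightarrow> real" where "dX v = (fst (fst v) - k * snd (fst v)) / r" for v
  have g': "(?g has_derivative (\<lambda>v. (dX v, snd (fst v)))) (at w0)"
    using has_derivative_compose[OF has_derivative_fst[OF has_derivative_ident] uncollapse_has_derivative[OF nl]]
    by (simp add: dX_def k_def r_def p_def)
  obtain A where A: "((\<lambda>q. height (fst q) (snd q)) has_derivative (\<lambda>v. A * fst v + r * snd v)) (at p)"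
    using height_has_derivative[OF p] unfolding r_def by blast
  have "((\<lambda>w. height (fst (?g w)) (snd (?g w))) has_derivative (\<lambda>v. A * dX v + r * snd (fst v))) (at w0)"
    using has_derivative_compose[OF g' A[unfolded p_def]] by simp
  then have "((\<lambda>w. sqradius (fst (?g w)) (snd (?g w))) has_derivative
      (\<lambda>v. 0 + (A * dX v + r * snd (fst v)) / pi)) (at w0)"
    unfolding sqradius_def
    by (intro has_derivative_add has_derivative_const bounded_linear.has_derivative[OF bounded_linear_divide])
  moreover have "((\<lambda>w. pi - 2 * pi * fst (?g w)) has_derivative (\<lambda>v. 0 - 2 * pi * dX v)) (at w0)"
    using has_derivative_fst[OF g']
    by (intro has_derivative_diff has_derivative_const has_derivative_mult_right) simp
  moreover have "0 < sqradius (fst (?g w0)) (snd (?g w0))" using sqradius_bounds(1) order.strict_trans zero_less_numeral by blast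
  ultimately obtain P' Q' where
    P: "((\<lambda>w. sqrt (sqradius (fst (?g w)) (snd (?g w))) * cos (pi - 2 * pi * fst (?g w))) has_derivative P') (at w0)" and
    Q: "((\<lambda>w. sqrt (sqradius (fst (?g w)) (snd (?g w))) * sin (pi - 2 * pi * fst (?g w))) has_derivative Q') (at w0)" and
    PQ: "\<And>v u. P' v * Q' u - Q' v * P' u = ((0 + (A * dX v + r * snd (fst v)) / pi) * (0 - 2 * pi * dX u)
        - (0 - 2 * pi * dX v) * (0 + (A * dX u + r * snd (fst u)) / pi)) / 2"
    by (rule pol_has_derivative) blast
  \<comment> \<open>The terms with \<open>A\<close> cancel by antisymmetry. What remains is
    \<open>rho\<close> times \<open>dX \<and> dy\<close>, and here the factor 1 / \<open>rho\<close>
    in the derivative of \<open>uncollapse\<close> restores the standard form.\<close>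
  have PQ': "P' v * Q' u - Q' v * P' u = fst (fst v) * snd (fst u) - snd (fst v) * fst (fst u)" for v u
  proof -
    have "P' v * Q' u - Q' v * P' u = r * (dX v * snd (fst u) - snd (fst v) * dX u)"
      unfolding PQ by (simp add: field_simps)
    also have "\<dots> = fst (fst v) * snd (fst u) - snd (fst v) * fst (fst u)"
      unfolding dX_def using r by (simp add: field_simps)
    finally show ?thesis .
  qed
  obtain x' y' where x: "(disc_x has_derivative x') (at (snd w0))" and y: "(disc_y has_derivative y') (at (snd w0))"
    and xy: "\<And>v u. x' v * y' u - y' v * x' u = fst v * snd u - snd v * fst u"
    using disc_has_derivative[OF zb] by blast
  have x2: "((\<lambda>w. disc_x (snd w)) has_derivative (\<lambda>v. x' (snd v))) (at w0)"
    and y2: "((\<lambda>w. disc_y (snd w)) has_derivative (\<lambda>v. y' (snd v))) (at w0)"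
    using has_derivative_compose[OF has_derivative_snd[OF has_derivative_ident] x]
      has_derivative_compose[OF has_derivative_snd[OF has_derivative_ident] y] by simp_all
  have "\<bar>disc_y (snd w0)\<bar> < 1/2" by (rule disc_bounds[OF zb])
  moreover have "0 \<le> a * sg (cP (fst (?g w0)) (snd (?g w0)))" using U(4) sg_props(3) by simp
  ultimately have c2: "0 < disc_y (snd w0) + a * sg (cP (fst (?g w0)) (snd (?g w0))) + 1/2" by linarith
  obtain D where D: "((\<lambda>w. target e a b (cP (fst (?g w)) (snd (?g w))) (cQ (fst (?g w)) (snd (?g w)))
      (disc_x (snd w)) (disc_y (snd w))) has_derivative D) (at w0)"
    "\<And>v u. omega (D v) (D u) = e * (P' v * Q' u - Q' v * P' u) + (x' (snd v) * y' (snd u) - y' (snd v) * x' (snd u))"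
    using target_has_derivative[OF P[folded cP_def] Q[folded cQ_def] x2 y2 e target_sqradius_pos[OF e] c2] by blast
  have oV: "open (unit_dom \<inter> ?g -` U)"
  proof (rule continuous_open_preimage[OF _ open_unit_dom U(1)])
    have "continuous_on (UNIV - lattice 1) uncollapse"
      using smooth_on_imp_continuous_on[OF smooth_on_uncollapse] .
    then show "continuous_on unit_dom ?g"
      by (rule continuous_on_compose2) (auto intro: continuous_intros)
  qed
  have "((\<lambda>w. unit_emb (e, w)) has_derivative D) (at w0)"
    by (rule has_derivative_transform_within_open[OF D(1) oV])
      (use w0 U(2) in \<open>auto simp: p_def unit_emb_def Let_def U(5)\<close>)
  then show ?thesis
    by (rule that) (simp add: D(2) PQ' xy)
qed

lemma unit_emb_periodic:
  assumes "u \<notin> lattice 1"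
  shows "unit_emb (e, u + (of_int m, of_int n), z) = unit_emb (e, u, z)"
  unfolding unit_emb_def Let_def fst_conv snd_conv uncollapse_shift[OF assms] fst_add snd_add
  by (simp only: add.assoc[symmetric] shift_invariants)

section \<open>Injectivity\<close>

lemma pol_inj:
  assumes "0 < c" "0 < c'" "\<bar>t\<bar> < pi" "\<bar>t'\<bar> < pi" "pol c t = pol c' t'"
  shows "c = c'" "t = t'"
proof -
  have n: "(sqrt c * cos t)\<^sup>2 + (sqrt c * sin t)\<^sup>2 = c" if "0 < c" for c t
  proof -
    have "(sqrt c * cos t)\<^sup>2 + (sqrt c * sin t)\<^sup>2 = (sqrt c)\<^sup>2 * ((cos t)\<^sup>2 + (sin t)\<^sup>2)"
      by (simp only: power_mult_distrib distrib_left)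
    then show ?thesis using that by simp
  qed
  have eq: "sqrt c * cos t = sqrt c' * cos t'" "sqrt c * sin t = sqrt c' * sin t'"
    using assms(5) by (auto simp: pol_def)
  show c: "c = c'" using n[OF assms(1), of t] n[OF assms(2), of t'] eq by simp
  then have "sin t = sin t' \<and> cos t = cos t'" using eq assms(1) by simp
  then obtain k :: int where k: "t = t' + 2 * pi * of_int k" using sin_cos_eq_iff[of t t'] by blast
  have "\<bar>2 * pi * of_int k\<bar> < 2 * pi * 1" using k assms(3,4) by linarith
  then have "\<bar>real_of_int k\<bar> < 1" unfolding abs_mult by simp
  then have "k = 0" by linarith
  then show "t = t'" using k by simp
qed

text \<open>Keeps the angle within half a turn to either side, where polar coordinates are
  injective: the translation term is at most \<open>pi * deriv sg P\<close>, and
  \<open>rmax * e\<close> majorises \<open>e * \<bar>Q\<bar>\<close>.\<close>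

lemma bulge_bound:
  assumes "0 < e" "\<bar>Q\<bar> < rmax" "\<bar>x\<bar> < pi / 2"
  shows "\<bar>- bulge e (of_bool A) (of_bool B) P Q x / (deriv sg P + rmax * e)\<bar> < pi"
proof -
  let ?d = "deriv sg P"
  have d: "0 \<le> ?d" by (rule sg_props)
  have F: "0 < ?d + rmax * e" using d assms(1) rmax_pos by (simp add: add_nonneg_pos)
  have m: "\<bar>of_bool A * (x - pi / 2) + of_bool B * pi\<bar> \<le> pi"
    using assms(3) pi_gt_zero by (cases A; cases B) (simp_all add: abs_le_iff abs_less_iff, linarith?)
  have "\<bar>bulge e (of_bool A) (of_bool B) P Q x\<bar> \<le> \<bar>e * Q\<bar> + \<bar>?d * (of_bool A * (x - pi / 2) + of_bool B * pi)\<bar>"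
    unfolding bulge_def by (rule abs_triangle_ineq)
  also have "\<dots> \<le> e * \<bar>Q\<bar> + ?d * pi"
    unfolding abs_mult using assms(1) d m by (intro add_mono mult_mono) auto
  also have "\<dots> < e * rmax + ?d * pi" using assms by simp
  also have "\<dots> \<le> pi * (rmax * e) + ?d * pi"
  proof -
    have "1 * (rmax * e) \<le> pi * (rmax * e)" using assms(1) rmax_pos pi_gt3 by (intro mult_right_mono) auto
    then show ?thesis by (simp add: mult.commute)
  qed
  finally have "\<bar>bulge e (of_bool A) (of_bool B) P Q x\<bar> < pi * (?d + rmax * e)" by (simp add: algebra_simps)
  then show ?thesis using F by (simp add: abs_divide divide_less_eq)
qed

lemma sg_strict_mono_perturbed:
  assumes "0 < k" "sg P + k * P = sg P' + k * P'"
  shows "P = P'"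
proof -
  have "sg s \<le> sg t" if "s \<le> t" for s t
    by (rule DERIV_nonneg_imp_nondecreasing[OF that])
      (use smooth_on_real_has_derivative[OF sg_props(1)] sg_props(5) in blast)
  then have "sg s + k * s < sg t + k * t" if "s < t" for s t
    using that assms(1) by (intro add_le_less_mono mult_strict_left_mono) auto
  from this[of P P'] this[of P' P] assms(2) show ?thesis by (cases P P' rule: linorder_cases) auto
qed

text \<open>Both sheets have been bent, but for equal \<open>P\<close> and \<open>x\<close> their
  order in \<open>Q\<close> survives because the added offsets are ordered in the same way. This is
  where the offsets \<open>- pi / 2\<close> and \<open>b * pi\<close> are needed.\<close>

lemma bulge_mono:
  assumes e: "0 < e" and x: "\<bar>x\<bar> < pi / 2"
    and sl: "(X1, y1) \<in> slit_plane" "(X2, y2) \<in> slit_plane"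
    and P: "cP X1 y1 = cP X2 y2" "cP X1 y1 < 9/4" and Q: "cQ X1 y1 < cQ X2 y2"
  shows "bulge e (of_bool (0 < side X1 y1)) (of_bool (0 < cQ X1 y1)) (cP X1 y1) (cQ X1 y1) x
    < bulge e (of_bool (0 < side X2 y2)) (of_bool (0 < cQ X2 y2)) (cP X2 y2) (cQ X2 y2) x"
proof (cases "0 < cP X1 y1")
  case False
  then have "deriv sg (cP X1 y1) = 0" by (intro sg_props) auto
  then show ?thesis using e Q P by (simp add: bulge_def)
next
  case True
  let ?m = "\<lambda>X y. of_bool (0 < side X y) * (x - pi / 2) + of_bool (0 < cQ X y) * pi"
  have s1: "0 < side X1 y1 \<longleftrightarrow> cQ X1 y1 * height X1 y1 < 0" "cQ X1 y1 \<noteq> 0"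
    using side_pos_iff[OF True P(2) sl(1)] by auto
  have s2: "0 < side X2 y2 \<longleftrightarrow> cQ X2 y2 * height X2 y2 < 0" "cQ X2 y2 \<noteq> 0"
    using side_pos_iff[of X2 y2] True P sl(2) by auto
  have h: "height X2 y2 - height X1 y1 = pi * ((cQ X2 y2)\<^sup>2 - (cQ X1 y1)\<^sup>2)"
  proof -
    have "sqradius X2 y2 - sqradius X1 y1 = (cQ X2 y2)\<^sup>2 - (cQ X1 y1)\<^sup>2"
      using cP_cQ_sqradius[of X1 y1] cP_cQ_sqradius[of X2 y2] P(1) by simp
    then have "(height X2 y2 - height X1 y1) / pi = (cQ X2 y2)\<^sup>2 - (cQ X1 y1)\<^sup>2"
      by (simp add: sqradius_def diff_divide_distrib)
    then show ?thesis by (simp add: divide_eq_eq mult.commute)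
  qed
  \<comment> \<open>For \<open>(a, b)\<close> equal to \<open>(1, 0)\<close>, \<open>(0, 0)\<close>,
    \<open>(1, 1)\<close>, \<open>(0, 1)\<close> the offsets are \<open>x - pi / 2\<close>, 0,
    \<open>x + pi / 2\<close>, \<open>pi\<close>, in increasing order. The sheets occur in this
    order of increasing \<open>Q\<close> by \<open>side_pos_iff\<close>.\<close>
  have neg: "x - pi / 2 < 0" "0 < x + pi / 2" using x by auto
  have "?m X1 y1 \<le> ?m X2 y2"
  proof (cases "0 < cQ X1 y1")
    case True
    then have Q2: "0 < cQ X2 y2" using Q by linarith
    have "(cQ X1 y1)\<^sup>2 < (cQ X2 y2)\<^sup>2" using True Q by (intro power_strict_mono) auto
    then have "0 < pi * ((cQ X2 y2)\<^sup>2 - (cQ X1 y1)\<^sup>2)" by simp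
    then have "height X1 y1 < height X2 y2" using h by linarith
    then have "0 < side X2 y2 \<longrightarrow> 0 < side X1 y1"
      using s1 s2 True Q2 by (auto simp: mult_less_0_iff)
    then show ?thesis using True Q2 neg by auto
  next
    case False
    then have Q1: "cQ X1 y1 < 0" using s1 by simp
    show ?thesis
    proof (cases "0 < cQ X2 y2")
      case True
      then show ?thesis using Q1 neg by auto
    next
      case False
      then have Q2: "cQ X2 y2 < 0" using s2 by simp
      have "(- cQ X2 y2)\<^sup>2 < (- cQ X1 y1)\<^sup>2" using Q2 Q by (intro power_strict_mono) auto
      then have "(cQ X2 y2)\<^sup>2 < (cQ X1 y1)\<^sup>2" by simp
      then have "pi * ((cQ X2 y2)\<^sup>2 - (cQ X1 y1)\<^sup>2) < 0" by (simp add: mult_pos_neg)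
      then have "height X2 y2 < height X1 y1" using h by linarith
      then have "0 < side X2 y2 \<longrightarrow> 0 < side X1 y1"
        using s1 s2 Q1 Q2 by (auto simp: mult_less_0_iff)
      then show ?thesis using Q1 Q2 neg by auto
    qed
  qed
  then have "deriv sg (cP X1 y1) * ?m X1 y1 \<le> deriv sg (cP X1 y1) * ?m X2 y2"
    by (intro mult_left_mono sg_props)
  moreover have "e * cQ X1 y1 < e * cQ X2 y2" using e Q by simp
  ultimately show ?thesis unfolding bulge_def P(1)[symmetric] by (intro add_less_le_mono)
qed

text \<open>The fibre disc yields \<open>x\<close> and the translated \<open>y\<close>, the base
  disc yields \<open>P\<close> and the bulge. Below 9/4 the bulge determines \<open>Q\<close>. From
  9/4 on it is \<open>e * Q\<close>, and the sheets are told apart by the fibre, since open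
  intervals of length 1 translated by 0 and by 1 are disjoint.\<close>

lemma unit_emb_inj:
  assumes e: "0 < e" and w: "(u1, z1) \<in> unit_dom" "(u2, z2) \<in> unit_dom"
    and eq: "unit_emb (e, u1, z1) = unit_emb (e, u2, z2)"
  shows "z1 = z2" "u1 - u2 \<in> lattice 1"
proof -
  obtain X1 y1 X2 y2 where g: "uncollapse u1 = (X1, y1)" "uncollapse u2 = (X2, y2)" by fastforce
  have sl: "(X1, y1) \<in> slit_plane" "(X2, y2) \<in> slit_plane"
    and col: "collapse (X1, y1) = u1" "collapse (X2, y2) = u2"
    using uncollapse_props[of u1] uncollapse_props[of u2] w g by auto
  have z: "z1 \<in> ball 0 1" "z2 \<in> ball 0 1" using w by auto
  let ?a1 = "of_bool (0 < side X1 y1) :: real" and ?a2 = "of_bool (0 < side X2 y2) :: real"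
  let ?b1 = "of_bool (0 < cQ X1 y1) :: real" and ?b2 = "of_bool (0 < cQ X2 y2) :: real"
  let ?P1 = "cP X1 y1" and ?P2 = "cP X2 y2" and ?Q1 = "cQ X1 y1" and ?Q2 = "cQ X2 y2"
  let ?x1 = "disc_x z1" and ?x2 = "disc_x z2"
  have "target e ?a1 ?b1 ?P1 ?Q1 ?x1 (disc_y z1) = target e ?a2 ?b2 ?P2 ?Q2 ?x2 (disc_y z2)"
    using eq by (simp add: unit_emb_def g)
  then have pol1: "pol (2 * (1 + rmax\<^sup>2 * e - sg ?P1 - rmax * e * ?P1)) (- bulge e ?a1 ?b1 ?P1 ?Q1 ?x1 / (deriv sg ?P1 + rmax * e))
      = pol (2 * (1 + rmax\<^sup>2 * e - sg ?P2 - rmax * e * ?P2)) (- bulge e ?a2 ?b2 ?P2 ?Q2 ?x2 / (deriv sg ?P2 + rmax * e))"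
    and pol2: "pol (disc_y z1 + ?a1 * sg ?P1 + 1/2) (- 2 * ?x1) = pol (disc_y z2 + ?a2 * sg ?P2 + 1/2) (- 2 * ?x2)"
    by (simp_all only: target_def prod.inject)
  have xb: "\<bar>?x1\<bar> < pi / 2" "\<bar>?x2\<bar> < pi / 2" using disc_bounds(1) z by auto
  have yb: "\<bar>disc_y z1\<bar> < 1/2" "\<bar>disc_y z2\<bar> < 1/2" using disc_bounds(2) z by auto
  have sp: "0 \<le> ?a1 * sg ?P1" "0 \<le> ?a2 * sg ?P2" using sg_props(3) by auto
  have "0 < disc_y z1 + ?a1 * sg ?P1 + 1/2" "0 < disc_y z2 + ?a2 * sg ?P2 + 1/2" using yb sp by linarith+
  moreover have "\<bar>- 2 * ?x1\<bar> < pi" "\<bar>- 2 * ?x2\<bar> < pi" using xb by linarith+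
  ultimately have y: "disc_y z1 + ?a1 * sg ?P1 = disc_y z2 + ?a2 * sg ?P2" and x: "?x1 = ?x2"
    using pol_inj[OF _ _ _ _ pol2] by auto
  note p1 = pol_inj[OF target_sqradius_pos[OF e] target_sqradius_pos[OF e]
      bulge_bound[OF e cQ_bound xb(1)] bulge_bound[OF e cQ_bound xb(2)] pol1]
  have re: "0 < rmax * e" using e rmax_pos by simp
  have P: "?P1 = ?P2"
    by (rule sg_strict_mono_perturbed[OF re]) (use p1(1) in simp)
  have "deriv sg ?P1 + rmax * e \<noteq> 0" using re sg_props(5)[of ?P1] by linarith
  then have h: "bulge e ?a1 ?b1 ?P1 ?Q1 ?x1 = bulge e ?a2 ?b2 ?P2 ?Q2 ?x1"
    using p1(2) P x by simp
  have "?Q1 = ?Q2 \<and> (?P1 < 9/4 \<or> 0 < ?P1 \<and> (0 < side X1 y1 \<longleftrightarrow> 0 < side X2 y2))"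
  proof (cases "?P1 < 9/4")
    case True
    then show ?thesis
      using bulge_mono[OF e xb(1) sl P] bulge_mono[OF e xb(1) sl(2,1) P[symmetric]] P h
      by (cases ?Q1 ?Q2 rule: linorder_cases) auto
  next
    case False
    then have "deriv sg ?P1 = 0" "sg ?P1 = 1" by (intro sg_props; simp)+
    then have "e * ?Q1 = e * ?Q2" and "disc_y z1 + ?a1 = disc_y z2 + ?a2"
      using h y P by (auto simp: bulge_def)
    then show ?thesis using e False yb by (auto split: if_splits simp: of_bool_def)
  qed
  then obtain n m :: int where nm: "X2 = X1 + of_int n + of_int m * 2" "y2 = y1 + of_int n"
    using base_inj[OF sl P] by blast
  have "side X2 y2 = side X1 y1" unfolding nm by (rule shift_invariants)
  then have "disc_y z1 = disc_y z2" using y P by simp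
  with x show "z1 = z2" using disc_inj[OF z] by blast
  have "u2 = u1 + (of_int m, of_int n)"
    using col xi_shift[of X1 n m y1] by (auto simp: collapse_def nm)
  then have "u1 - u2 = (of_int (- m), of_int (- n))" by simp
  then show "u1 - u2 \<in> lattice 1" unfolding lattice_def by (intro CollectI exI[of _ "- m"] exI[of _ "- n"]) simp
qed

text \<open>The squared norm is the sum of the two squared radii: at most
  \<open>2 - 2 * sg P + 4 * rmax\<^sup>2 * e\<close> from the base and less than
  \<open>1 + sg P\<close> from the fibre.\<close>

lemma unit_emb_bound:
  assumes e: "0 < e" and z: "z \<in> ball 0 1"
  shows "norm (unit_emb (e, u, z)) < sqrt 3 + 2 * rmax\<^sup>2 * e"
proof -
  obtain X y where g: "uncollapse u = (X, y)" by fastforce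
  let ?P = "cP X y" and ?a = "of_bool (0 < side X y) :: real"
  let ?c1 = "2 * (1 + rmax\<^sup>2 * e - sg ?P - rmax * e * ?P)" and ?c2 = "disc_y z + ?a * sg ?P + 1/2"
  have npol: "norm (pol c t) ^ 2 = c" if "0 < c" for c t
  proof -
    have "norm (pol c t) ^ 2 = (sqrt c)\<^sup>2 * ((cos t)\<^sup>2 + (sin t)\<^sup>2)"
      unfolding pol_def norm_prod_def
      by (simp only: power_mult_distrib distrib_left real_norm_def power2_abs fst_conv snd_conv)
        (simp add: add_nonneg_nonneg)
    then show ?thesis using that by (simp only: sin_cos_squared_add2) simp
  qed
  have sp: "0 \<le> ?a * sg ?P" "?a * sg ?P \<le> sg ?P" "sg ?P \<le> 1" "0 \<le> sg ?P" using sg_props(3,4)[of ?P] by auto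
  have yb: "\<bar>disc_y z\<bar> < 1/2" by (rule disc_bounds(2)[OF z])
  have c: "0 < ?c1" "0 < ?c2" using target_sqradius_pos[OF e] sp yb by auto
  have "(norm (unit_emb (e, u, z)))\<^sup>2 = ?c1 + ?c2"
    using c by (simp add: unit_emb_def g target_def norm_prod_def[of "(_ , _ :: real \<times> real)"] npol)
  also have "\<dots> < 3 + 4 * rmax\<^sup>2 * e"
  proof -
    have "rmax * e * - ?P \<le> rmax * e * rmax"
      using e rmax_pos cP_bound[of X y] by (intro mult_left_mono) auto
    then have "- (rmax * e * ?P) \<le> rmax\<^sup>2 * e" by (simp add: power2_eq_square mult_ac)
    moreover have "2 * (1 + A - s - B) + (d + t + 1/2) < 3 + 4 * A"
      if "- B \<le> A" "t \<le> s" "0 \<le> s" "d < 1/2" for A B d s t :: real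
      using that by (simp add: field_simps)
    moreover have "disc_y z < 1/2" using yb by simp
    ultimately show ?thesis using sp unfolding mult.assoc[of 4] by blast
  qed
  \<comment> \<open>The mixed term of the square is \<open>4 * rmax\<^sup>2 * e * sqrt 3\<close>,
    which already covers the excess over 3.\<close>
  also have "\<dots> \<le> (sqrt 3 + 2 * rmax\<^sup>2 * e)\<^sup>2"
  proof -
    have "1 \<le> sqrt 3" by simp
    then have "4 * rmax\<^sup>2 * e * 1 \<le> 4 * rmax\<^sup>2 * e * sqrt 3" using e by (intro mult_left_mono) auto
    moreover have "(sqrt 3 + 2 * rmax\<^sup>2 * e)\<^sup>2 = 3 + 4 * rmax\<^sup>2 * e * sqrt 3 + (2 * rmax\<^sup>2 * e)\<^sup>2"
      by (simp add: power2_sum)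
    moreover have "0 \<le> (2 * rmax\<^sup>2 * e)\<^sup>2" by simp
    ultimately show ?thesis unfolding mult_1_right by linarith
  qed
  finally show ?thesis
    by (rule power2_less_imp_less) (use e in auto)
qed

section \<open>Rescaling by \<open>sqrt e\<close> and conclusion\<close>

definition emb :: "real \<Rightarrow> (real \<times> real) \<times> (real \<times> real) \<Rightarrow> (real \<times> real) \<times> (real \<times> real)" where
  "emb e q = unit_emb (e, (1 / sqrt e) *\<^sub>R fst q, snd q)"

lemma lattice_scale:
  assumes "0 < s"
  shows "(1 / s) *\<^sub>R l \<in> lattice 1 \<longleftrightarrow> l \<in> lattice s"
  using assms by (cases l) (auto simp: lattice_def field_simps)

lemma cover_dom_scale:
  assumes "0 < e"
  shows "((1 / sqrt e) *\<^sub>R fst q, snd q) \<in> unit_dom \<longleftrightarrow> q \<in> cover_dom e"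
  using lattice_scale[of "sqrt e" "fst q"] assms by (cases q) (auto simp: cover_dom_def)

lemma open_cover_dom:
  assumes "0 < e"
  shows "open (cover_dom e)"
proof -
  have "cover_dom e = (\<lambda>q. ((1 / sqrt e) *\<^sub>R fst q, snd q)) -` unit_dom"
    using cover_dom_scale[OF assms] by blast
  also have "open \<dots>" by (intro open_vimage open_unit_dom continuous_intros)
  finally show ?thesis .
qed

lemma smooth_on_emb:
  assumes "0 < e"
  shows "smooth_on (cover_dom e) (emb e)"
proof -
  have o: "open ({0::real<..} \<times> unit_dom)" by (intro open_Times open_unit_dom) auto
  have "bounded_linear (\<lambda>q :: (real \<times> real) \<times> (real \<times> real). (1 / sqrt e) *\<^sub>R fst q)"
    by (intro bounded_linear_scaleR_right[THEN bounded_linear_compose] bounded_linear_fst)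
  then have "smooth_on (cover_dom e) (\<lambda>q. (e, (1 / sqrt e) *\<^sub>R fst q, snd q))"
    by (intro smooth_on_Pair smooth_on_const smooth_on_bounded_linear open_cover_dom[OF assms] bounded_linear_snd)
  from smooth_on_compose[OF open_cover_dom[OF assms] o _ smooth_on_unit_emb this]
  show ?thesis unfolding emb_def[abs_def] using assms cover_dom_scale[OF assms] by simp
qed

lemma emb_periodic:
  assumes e: "0 < e" and q: "q \<in> cover_dom e" and l: "l \<in> lattice (sqrt e)"
  shows "emb e (fst q + l, snd q) = emb e q"
proof -
  have nl: "(1 / sqrt e) *\<^sub>R fst q \<notin> lattice 1" using cover_dom_scale[OF e, of q] q by simp
  from l obtain m n :: int where mn: "l = (sqrt e * of_int m, sqrt e * of_int n)" by (auto simp: lattice_def)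
  have "(1 / sqrt e) *\<^sub>R (fst q + l) = (1 / sqrt e) *\<^sub>R fst q + (of_int m, of_int n)"
    using e by (simp add: scaleR_add_right mn)
  then show ?thesis unfolding emb_def fst_conv snd_conv using unit_emb_periodic[OF nl] by simp
qed

lemma emb_inj:
  assumes e: "0 < e" and q: "q1 \<in> cover_dom e" "q2 \<in> cover_dom e" and eq: "emb e q1 = emb e q2"
  shows "snd q1 = snd q2" "fst q1 - fst q2 \<in> lattice (sqrt e)"
proof -
  have w: "((1 / sqrt e) *\<^sub>R fst q1, snd q1) \<in> unit_dom" "((1 / sqrt e) *\<^sub>R fst q2, snd q2) \<in> unit_dom"
    using cover_dom_scale[OF e] q by blast+
  note i = unit_emb_inj[OF e w eq[unfolded emb_def]]
  show "snd q1 = snd q2" by (rule i)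
  have "(1 / sqrt e) *\<^sub>R (fst q1 - fst q2) \<in> lattice 1" using i(2) by (simp add: scaleR_diff_right)
  then show "fst q1 - fst q2 \<in> lattice (sqrt e)" using lattice_scale[of "sqrt e"] e by simp
qed

text \<open>The dilation divides the area form of the base by \<open>e\<close>, cancelling the
  factor in \<open>unit_emb_symplectic\<close>.\<close>

lemma emb_symplectic:
  assumes e: "0 < e" and q: "q \<in> cover_dom e"
  shows "\<exists>D. (emb e has_derivative D) (at q) \<and> (\<forall>v w. omega (D v) (D w) = omega v w)"
proof -
  let ?L = "\<lambda>q :: (real \<times> real) \<times> (real \<times> real). ((1 / sqrt e) *\<^sub>R fst q, snd q)"
  have "?L q \<in> unit_dom" using cover_dom_scale[OF e] q by blast
  then obtain D where D: "((\<lambda>w. unit_emb (e, w)) has_derivative D) (at (?L q))"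
    "\<And>v u. omega (D v) (D u) = e * (fst (fst v) * snd (fst u) - snd (fst v) * fst (fst u))
      + (fst (snd v) * snd (snd u) - snd (snd v) * fst (snd u))"
    using unit_emb_symplectic[OF e] by blast
  have "(?L has_derivative ?L) (at q)" by (auto intro!: derivative_eq_intros)
  from has_derivative_compose[OF this D(1)]
  have "(emb e has_derivative (\<lambda>v. D (?L v))) (at q)" by (simp add: emb_def[abs_def])
  moreover have "omega (D (?L v)) (D (?L u)) = omega v u" for v u
  proof -
    have s: "sqrt e * sqrt e = e" "sqrt e \<noteq> 0" using e by auto
    have "e * (a / sqrt e * (b / sqrt e) - c / sqrt e * (d / sqrt e)) = a * b - c * d" for a b c d
      using s e by (simp add: field_simps)
    then show ?thesis unfolding D(2) by (simp add: omega_def)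
  qed
  ultimately show ?thesis by blast
qed

lemma lattice_small:
  assumes "0 < s" "l \<in> lattice s" "norm l < s"
  shows "l = 0"
proof -
  obtain m n :: int where l: "l = (s * of_int m, s * of_int n)" using assms(2) by (auto simp: lattice_def)
  have "\<bar>s * of_int m\<bar> < s * 1" "\<bar>s * of_int n\<bar> < s * 1"
    using norm_fst_le[of "s * of_int m" "s * of_int n"] norm_snd_le[of "s * of_int n" "s * of_int m"] assms(3) l by auto
  then have "\<bar>real_of_int m\<bar> < 1" "\<bar>real_of_int n\<bar> < 1" using assms(1) by (simp_all add: abs_mult)
  then have "m = 0" "n = 0" by linarith+
  then show ?thesis by (simp add: l zero_prod_def)
qed

text \<open>Continuity of the inverse on the quotient. By invariance of domain the image of a small
  ball around \<open>p\<close> is open, so a point whose image is near that of \<open>p\<close> has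
  the same image as some point of the ball, and by injectivity it is a lattice translate of that
  point.\<close>

lemma emb_topological:
  assumes e: "0 < e" and p: "p \<in> cover_dom e" and d: "0 < \<delta>"
  shows "\<exists>\<eta>>0. \<forall>q\<in>cover_dom e. dist (emb e q) (emb e p) < \<eta> \<longrightarrow>
    (\<exists>l\<in>lattice (sqrt e). dist (fst q + l, snd q) p < \<delta>)"
proof -
  \<comment> \<open>Two points of such a ball differ by less than \<open>sqrt e\<close>, the length
    of a shortest lattice vector, so \<open>emb e\<close> is injective on it.\<close>
  define r where "r = min \<delta> (sqrt e / 2)"
  have r: "0 < r" "r \<le> \<delta>" "r \<le> sqrt e / 2" using d e by (auto simp: r_def)
  let ?B = "cover_dom e \<inter> ball p r"
  have oB: "open ?B" by (intro open_Int open_cover_dom[OF e] open_ball)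
  have inj: "inj_on (emb e) ?B"
  proof (rule inj_onI)
    fix q q' assume q: "q \<in> ?B" "q' \<in> ?B" "emb e q = emb e q'"
    have "norm (fst q - fst q') \<le> norm (q - q')" using norm_fst_le[of "fst q - fst q'" "snd q - snd q'"] by (simp add: minus_prod_def)
    also have "\<dots> < r + r" using q dist_triangle2[of q q' p] by (auto simp: dist_norm[symmetric] dist_commute)
    finally have "norm (fst q - fst q') < sqrt e" using r by linarith
    moreover have "fst q - fst q' \<in> lattice (sqrt e)" "snd q = snd q'" using emb_inj[OF e _ _ q(3)] q by auto
    ultimately have "fst q - fst q' = 0" using lattice_small[of "sqrt e" "fst q - fst q'"] e by simp
    then show "q = q'" using \<open>snd q = snd q'\<close> by (simp add: prod_eq_iff)
  qed
  have "continuous_on ?B (emb e)"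
    using smooth_on_imp_continuous_on[OF smooth_on_emb[OF e]] continuous_on_subset by blast
  then have "open (emb e ` ?B)" using invariance_of_domain[OF _ oB inj] by blast
  moreover have "emb e p \<in> emb e ` ?B" using p r by auto
  ultimately obtain \<eta> where \<eta>: "\<eta> > 0" "ball (emb e p) \<eta> \<subseteq> emb e ` ?B" using open_contains_ball by blast
  have "\<exists>l\<in>lattice (sqrt e). dist (fst q + l, snd q) p < \<delta>"
    if q: "q \<in> cover_dom e" "dist (emb e q) (emb e p) < \<eta>" for q
  proof -
    have "emb e q \<in> emb e ` ?B" using \<eta> q by (auto simp: dist_commute)
    then obtain q' where q': "emb e q = emb e q'" "q' \<in> ?B" by blast
    have "snd q' = snd q" "fst q' - fst q \<in> lattice (sqrt e)" using emb_inj[OF e _ q(1), of q'] q' by auto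
    moreover from this have "(fst q + (fst q' - fst q), snd q) = q'" by (simp add: prod_eq_iff)
    moreover have "dist q' p < \<delta>" using q'(2) r by (auto simp: dist_commute)
    ultimately show ?thesis by metis
  qed
  with \<eta>(1) show ?thesis by blast
qed

theorem theorem5p1:
  shows "\<exists>e0>0. \<exists>c>0. \<exists>J. (\<forall>e\<in>{0<..e0}. torus_symp_embedding e (sqrt 3 + c * e) (J e))
           \<and> smooth_torus_family e0 J"
proof (intro exI conjI ballI)
  \<comment> \<open>The construction works for every positive \<open>e\<close>, so the bound 1 is an
    arbitrary choice; for the same reason \<open>unit_emb\<close> itself is the required smooth
    extension past the endpoint.\<close>
  show "(0::real) < 1" "0 < 2 * rmax\<^sup>2" using rmax_pos by auto
  show "torus_symp_embedding e (sqrt 3 + 2 * rmax\<^sup>2 * e) (emb e)" if "e \<in> {0<..1}" for e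
  proof -
    have e: "0 < e" using that by simp
    have "emb e q \<in> ball 0 (sqrt 3 + 2 * rmax\<^sup>2 * e)" if "q \<in> cover_dom e" for q
      using unit_emb_bound[OF e, of "snd q"] that by (auto simp: emb_def cover_dom_def)
    then have "emb e ` cover_dom e \<subseteq> ball 0 (sqrt 3 + 2 * rmax\<^sup>2 * e)" by blast
    then show ?thesis
      unfolding torus_symp_embedding_def
      by (intro conjI ballI allI impI smooth_on_emb[OF e] emb_periodic[OF e] emb_symplectic[OF e]
          emb_inj[OF e] emb_topological[OF e])
  qed
  show "smooth_torus_family 1 emb"
    unfolding smooth_torus_family_def
  proof (intro exI conjI ballI)
    show "open ({0<..} \<times> unit_dom :: (real \<times> (real \<times> real) \<times> (real \<times> real)) set)"
      by (intro open_Times open_unit_dom) auto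
    show "{0<..1} \<times> cover_dom 1 \<subseteq> ({0<..} \<times> unit_dom :: (real \<times> (real \<times> real) \<times> (real \<times> real)) set)"
      by (auto simp: cover_dom_def)
    show "smooth_on ({0<..} \<times> unit_dom) unit_emb" by (rule smooth_on_unit_emb)
    show "unit_emb (e, q) = emb e (sqrt e *\<^sub>R fst q, snd q)" if "e \<in> {0<..1}" for e q
      using that by (simp add: emb_def)
  qed
qed

end
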